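(* Let $A\subset\Omega$ be an increasing set. Then $$\frac{\partial}{\partial\lambda}\pi_\lambda(A)=E_\lambda\left[\int_X D_x^-1_A\,\sigma(dx)\right]=E_\lambda\left[\int_X D_x^+1_A\,\omega(dx)\right].$$ If $A\subset\Omega$ is decreasing, then $$\frac{\partial}{\partial\lambda}\pi_\lambda(A)=-E_\lambda\left[\int_X D_x^-1_A\,\omega(dx)\right]=-E_\lambda\left[\int_X D_x^+1_A\,\sigma(dx)\right].$$
   Context: $X$ is a metric space with Borel $\sigma$-algebra $\mathcal B(X)$ and $\sigma$ is a finite diffuse (atomless) measure on $X$. $\Omega$ is the set of Radon measures $\omega=\sum_{i=1}^N\delta_{x_i}$ with pairwise distinct $x_i\in X$, $N\in\mathbb N\cup\{\infty\}$; $\omega$ is identified with the set $\{x_1,x_2,\dots\}$. $\mathcal F$ is the $\sigma$-algebra generated by the maps $\omega\mapsto\omega(B)$, $B\in\mathcal B(X)$. For $\lambda>0$, $\pi_\lambda$ is the Poisson measure on $(\Omega,\mathcal F)$ with intensity $\lambda\sigma$, and $E_\lambda$ is expectation under $\pi_\lambda$. $D_xF(\omega)=(F(\omega)-F(\omega+\delta_x))1_{\{x\notin\omega\}}+(F(\omega)-F(\omega-\delta_x))1_{\{x\in\omega\}}$, $D_x^+F=\max(0,D_xF)$, $D_x^-F=-\min(0,D_xF)$. A measurable $A\subset\Omega$ is increasing if $\omega\in A$ implies $\omega+\delta_x\in A$ for $\sigma(dx)$-a.e. $x$; it is decreasing if $\omega\in A$ implies $\omega-\delta_x\in A$ for $\omega(dx)$-a.e.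 $x$.
   Formalization: Both expectations of integrals against ω(dx) carry a factor 1/λ; without it the statement fails for λ≠1, e.g. for A={ω(X)≥1}, where E_λ[∫D_x^+1_A ω(dx)] is λ times the derivative; at λ=1 it is the printed statement. *)

theory Defs
  imports "HOL-Probability.Probability"
begin

(* The measure "sum of the Dirac masses at the points of S", on the Borel sets. *)
definition dirac_sum :: "'a::metric_space set \<Rightarrow> 'a measure" where
  "dirac_sum S = distr (count_space S) borel (\<lambda>x. x)"

definition radon_measure :: "'a::metric_space measure \<Rightarrow> bool" where
  "radon_measure M \<longleftrightarrow>
     sets M = sets borel \<and>
     (\<forall>x. \<exists>U. open U \<and> x \<in> U \<and> emeasure M U < \<infinity>) \<and>
     (\<forall>B\<in>sets borel. emeasure M B = (SUP K\<in>{K. compact K \<and> K \<subseteq> B}. emeasure M K))"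

(* A configuration is represented by its set of points; the corresponding measure is
   dirac_sum.  Adding or removing a unit mass at x becomes insert x S or S - {x}, which
   is correct for x not in S, respectively x in S. *)
definition configurations :: "'a::metric_space set set" where
  "configurations = {S. countable S \<and> radon_measure (dirac_sum S)}"

definition config_space :: "'a::metric_space set measure" where
  "config_space = sigma configurations
     (\<Union>B\<in>sets borel. {(\<lambda>S. emeasure (dirac_sum S) B) -` C \<inter> configurations | C. C \<in> sets borel})"

(* Poisson law with rate r written out, since poisson_pmf needs r > 0 and null sets B have r = 0. *)
definition poisson_measure :: "'a::metric_space measure \<Rightarrow> 'a set measure \<Rightarrow> bool" where
  "poisson_measure \<mu> P \<longleftrightarrow>
     prob_space P \<and> sets P = sets config_space \<and>
     (\<forall>B\<in>sets borel. emeasure \<mu> B < \<infinity> \<longrightarrow>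
        (\<forall>k::nat. measure P {S \<in> space P. emeasure (dirac_sum S) B = of_nat k}
                    = exp (- measure \<mu> B) * measure \<mu> B ^ k / fact k)) \<and>
     (\<forall>(n::nat) B. (\<forall>i<n. B i \<in> sets borel) \<and> disjoint_family_on B {..<n} \<longrightarrow>
        prob_space.indep_vars P (\<lambda>_. borel) (\<lambda>i S. emeasure (dirac_sum S) (B i)) {..<n})"

definition D :: "'a \<Rightarrow> ('a set \<Rightarrow> real) \<Rightarrow> 'a set \<Rightarrow> real" where
  "D x F S = (F S - F (insert x S)) * indicator {S. x \<notin> S} S
             + (F S - F (S - {x})) * indicator {S. x \<in> S} S"

definition D_plus :: "'a \<Rightarrow> ('a set \<Rightarrow> real) \<Rightarrow> 'a set \<Rightarrow> real" where
  "D_plus x F S = max 0 (D x F S)"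

definition D_minus :: "'a \<Rightarrow> ('a set \<Rightarrow> real) \<Rightarrow> 'a set \<Rightarrow> real" where
  "D_minus x F S = - min 0 (D x F S)"

(* For diffuse \<sigma> the points x already in S form a null set, so insert x S is the
   configuration with a unit mass added at x for almost every x. *)
definition increasing_event :: "'a::metric_space measure \<Rightarrow> 'a set set \<Rightarrow> bool" where
  "increasing_event \<sigma> A \<longleftrightarrow> A \<in> sets config_space \<and> (\<forall>S\<in>A. AE x in \<sigma>. insert x S \<in> A)"

definition decreasing_event :: "'a::metric_space set set \<Rightarrow> bool" where
  "decreasing_event A \<longleftrightarrow> A \<in> sets config_space \<and> (\<forall>S\<in>A. AE x in dirac_sum S. S - {x} \<in> A)"

end

theory Submission imports Defs begin

text \<open>
  Almost surely the configuration \<open>\<omega>\<close> is finite. On finite configurations, \<open>\<pi>\<^sub>t\<close> has density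
  \<open>exp (- (t - l) \<sigma>(X)) (t / l)\<^sup>N\<close> with respect to \<open>\<pi>\<^sub>l\<close>, where \<open>N\<close> is the number of points. Hence
  \<open>\<pi>\<^sub>t (A)\<close> is an exponential times a power series in \<open>t / l\<close>, and its derivative at \<open>l\<close> is
  \<open>E [N 1\<^sub>A] / l - \<sigma>(X) \<pi>\<^sub>l (A)\<close>. The Mecke formula turns \<open>E [N 1\<^sub>A] / l\<close> into \<open>E [\<integral> 1\<^sub>A (\<omega> + \<delta>\<^sub>x) \<sigma>(dx)]\<close>, so
  the derivative is the difference of the expected \<open>\<sigma>\<close>-masses of the points whose addition makes \<open>\<omega>\<close>
  enter, respectively leave, \<open>A\<close>. For increasing \<open>A\<close> the second term vanishes and for decreasing \<open>A\<close>
  the first one does, and the Mecke formula exchanges addition with respect to \<open>\<sigma>\<close> and removal of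
  points of \<open>\<omega>\<close>.
\<close>

subsection \<open>Configurations\<close>

text \<open>The Mecke formula and the density are identities between set functions, so it suffices
  to check them on an intersection-stable generator. Counts on overlapping Borel sets are dependent;
  the generator therefore consists of events in the labels of one finite partition. There the law is
  a product of Poisson weights, the Mecke formula reduces to
  \<open>(k + 1) p(k + 1) = m p(k)\<close> in one cell of mass \<open>m\<close>, and the density to
  a quotient of weights.

  For events \<open>U\<close>, \<open>V\<close> let \<open>a(U, V)\<close> be the expectation, over
  configurations in \<open>U\<close>, of the mass under \<open>l\<close> times \<sigma> of the
  points whose addition leads into \<open>V\<close>. With \<open>B\<close> the complement of
  \<open>A\<close>, the mean number of points on \<open>A\<close> is
  \<open>a(A, A) + a(B, A)\<close>, while \<open>l\<close> \<sigma>(X) times the probability of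
  \<open>A\<close> is \<open>a(A, A) + a(A, B)\<close>. The common term cancels, so the derivative
  is \<open>(a(B, A) - a(A, B)) / l\<close> for every measurable \<open>A\<close>, and monotonicity
  deletes one of the two terms. An integral against \<sigma> absorbs the divisor \<open>l\<close>; a
  sum over the points of the configuration does not, which is the origin of the factor
  \<open>1 / l\<close> in front of the integrals against \<open>dirac_sum\<close>.\<close>

lemma sets_dirac_sum [simp, measurable_cong]: "sets (dirac_sum S) = sets borel"
  by (simp add: dirac_sum_def)

lemma space_dirac_sum [simp]: "space (dirac_sum S) = UNIV"
  by (simp add: dirac_sum_def)

lemma borel_countable: "countable S \<Longrightarrow> S \<in> sets (borel :: 'a::metric_space measure)"
  by (rule sets.countable) auto

lemma emeasure_dirac_sum:
  "B \<in> sets borel \<Longrightarrow> emeasure (dirac_sum S) B = emeasure (count_space S) (S \<inter> B)"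
  by (simp add: dirac_sum_def emeasure_distr Int_commute)

lemma emeasure_dirac_sum_finite:
  "B \<in> sets borel \<Longrightarrow> finite (S \<inter> B) \<Longrightarrow> emeasure (dirac_sum S) B = of_nat (card (S \<inter> B))"
  by (simp add: emeasure_dirac_sum emeasure_count_space_finite)

lemma emeasure_dirac_sum_infinite:
  "B \<in> sets borel \<Longrightarrow> infinite (S \<inter> B) \<Longrightarrow> emeasure (dirac_sum S) B = \<infinity>"
  by (simp add: emeasure_dirac_sum emeasure_count_space_infinite)

lemma emeasure_dirac_sum_less_top_iff:
  "B \<in> sets borel \<Longrightarrow> emeasure (dirac_sum S) B < \<infinity> \<longleftrightarrow> finite (S \<inter> B)"
  by (cases "finite (S \<inter> B)")
    (simp_all add: emeasure_dirac_sum_finite emeasure_dirac_sum_infinite of_nat_less_top)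

text \<open>Finite subsets of \<open>S \<inter> B\<close> are compact and their cardinalities
  exhaust the mass of \<open>B\<close>, which proves inner regularity for every \<open>S\<close>.
  Local finiteness is what distinguishes the Radon case.\<close>

lemma radon_measure_dirac_sum_iff:
  fixes S :: "'a::metric_space set"
  shows "radon_measure (dirac_sum S) \<longleftrightarrow> (\<forall>x. \<exists>U. open U \<and> x \<in> U \<and> finite (S \<inter> U))"
proof -
  have inner: "emeasure (dirac_sum S) B = (SUP K\<in>{K. compact K \<and> K \<subseteq> B}. emeasure (dirac_sum S) K)"
    if B: "B \<in> sets borel" for B
  proof (rule antisym)
    show "(SUP K\<in>{K. compact K \<and> K \<subseteq> B}. emeasure (dirac_sum S) K) \<le> emeasure (dirac_sum S) B"
      using B by (intro SUP_least emeasure_mono) auto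
    have fin: "of_nat (card F) \<le> (SUP K\<in>{K. compact K \<and> K \<subseteq> B}. emeasure (dirac_sum S) K)"
      if F: "finite F" "F \<subseteq> S \<inter> B" for F
    proof (rule SUP_upper2)
      show "F \<in> {K. compact K \<and> K \<subseteq> B}"
        using F by (auto simp: finite_imp_compact)
      have "S \<inter> F = F" "F \<in> sets borel"
        using F by (auto intro: borel_countable countable_finite)
      then show "of_nat (card F) \<le> emeasure (dirac_sum S) F"
        using F by (simp add: emeasure_dirac_sum_finite)
    qed
    show "emeasure (dirac_sum S) B \<le> (SUP K\<in>{K. compact K \<and> K \<subseteq> B}. emeasure (dirac_sum S) K)"
    proof (cases "finite (S \<inter> B)")
      case True
      then show ?thesis using fin[of "S \<inter> B"] B by (simp add: emeasure_dirac_sum_finite)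
    next
      case False
      have "of_nat n \<le> (SUP K\<in>{K. compact K \<and> K \<subseteq> B}. emeasure (dirac_sum S) K)" for n
        using infinite_arbitrarily_large[OF False, of n] fin by auto
      then have "(SUP n. of_nat n) \<le> (SUP K\<in>{K. compact K \<and> K \<subseteq> B}. emeasure (dirac_sum S) K)"
        by (intro SUP_least)
      then show ?thesis
        unfolding ennreal_SUP_of_nat_eq_top by (rule order_trans[OF top_greatest])
    qed
  qed
  show ?thesis
  proof -
    have "open U \<Longrightarrow> emeasure (dirac_sum S) U < \<infinity> \<longleftrightarrow> finite (S \<inter> U)" for U
      using emeasure_dirac_sum_less_top_iff[OF borel_open] by blast
    moreover have "\<forall>B\<in>sets borel. emeasure (dirac_sum S) B =
        (SUP K\<in>{K. compact K \<and> K \<subseteq> B}. emeasure (dirac_sum S) K)"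
      using inner by blast
    ultimately show ?thesis
      unfolding radon_measure_def sets_dirac_sum by metis
  qed
qed

lemma configurations_iff:
  "S \<in> configurations \<longleftrightarrow> countable S \<and> (\<forall>x. \<exists>U. open U \<and> x \<in> U \<and> finite (S \<inter> U))"
  by (simp add: configurations_def radon_measure_dirac_sum_iff)

lemma configurations_countable: "S \<in> configurations \<Longrightarrow> countable S"
  by (simp add: configurations_def)

lemma finite_configurations: "finite S \<Longrightarrow> S \<in> configurations"
  by (auto simp: configurations_iff countable_finite intro: exI[of _ UNIV])

lemma insert_configurations: "S \<in> configurations \<Longrightarrow> insert x S \<in> configurations"
  unfolding configurations_iff by (metis countable_insert finite.insertI Int_insert_left)

lemma Diff_configurations: "S \<in> configurations \<Longrightarrow> S - T \<in> configurations"
  unfolding configurations_iff by (metis Diff_Int_distrib2 countable_Diff finite_Diff)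

lemma emeasure_dirac_sum_insert:
  assumes B: "B \<in> sets borel" and x: "x \<notin> S"
  shows "emeasure (dirac_sum (insert x S)) B = emeasure (dirac_sum S) B + of_bool (x \<in> B)"
proof (cases "finite (S \<inter> B)")
  case True
  then show ?thesis using B x
    by (simp add: emeasure_dirac_sum_finite Int_insert_left)
next
  case False
  then show ?thesis using B x
    by (simp add: emeasure_dirac_sum_infinite Int_insert_left)
qed

lemma emeasure_dirac_sum_remove:
  assumes B: "B \<in> sets borel" and x: "x \<in> S"
  shows "emeasure (dirac_sum (S - {x})) B = emeasure (dirac_sum S) B - of_bool (x \<in> B)"
proof -
  \<comment> \<open>Subtracting the finite number \<open>of_bool (x \<in> B)\<close> undoes this
    addition even when the count is infinite.\<close>
  have "emeasure (dirac_sum S) B = emeasure (dirac_sum (S - {x})) B + of_bool (x \<in> B)"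
    using emeasure_dirac_sum_insert[OF B, of x "S - {x}"] x by (simp add: insert_absorb)
  then show ?thesis by simp
qed

lemma config_generators_subset:
  "(\<Union>B\<in>sets borel. {(\<lambda>S. emeasure (dirac_sum S) B) -` C \<inter> configurations | C. C \<in> sets borel})
    \<subseteq> Pow configurations"
  by auto

lemma space_config_space: "space config_space = configurations"
  unfolding config_space_def by (rule space_measure_of[OF config_generators_subset])

lemma sets_config_space:
  "sets config_space = sigma_sets configurations
     (\<Union>B\<in>sets borel. {(\<lambda>S. emeasure (dirac_sum S) B) -` C \<inter> configurations | C. C \<in> sets borel})"
  unfolding config_space_def by (rule sets_measure_of[OF config_generators_subset])

lemma measurable_count [measurable]:
  "B \<in> sets borel \<Longrightarrow> (\<lambda>S. emeasure (dirac_sum S) B) \<in> borel_measurable config_space"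
  by (rule measurableI) (auto simp: sets_config_space space_config_space)

lemma measurable_into_config_space:
  fixes f :: "'b \<Rightarrow> 'a::metric_space set"
  assumes "\<And>x. x \<in> space M \<Longrightarrow> f x \<in> configurations"
    and "\<And>B. B \<in> sets borel \<Longrightarrow> (\<lambda>x. emeasure (dirac_sum (f x)) B) \<in> borel_measurable M"
  shows "f \<in> M \<rightarrow>\<^sub>M config_space"
  unfolding config_space_def
proof (rule measurable_measure_of[OF config_generators_subset])
  show "f \<in> space M \<rightarrow> configurations" using assms(1) by auto
  fix y :: "'a set set" assume "y \<in> (\<Union>B\<in>sets borel. {(\<lambda>S. emeasure (dirac_sum S) B) -` C \<inter> configurations | C. C \<in> sets borel})"
  then obtain B C where B: "B \<in> sets borel" and C: "C \<in> sets borel"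
    and y: "y = (\<lambda>S. emeasure (dirac_sum S) B) -` C \<inter> configurations" by auto
  have "f -` y \<inter> space M = (\<lambda>x. emeasure (dirac_sum (f x)) B) -` C \<inter> space M"
    using assms(1) y by auto
  then show "f -` y \<inter> space M \<in> sets M"
    using measurable_sets[OF assms(2)[OF B] C] by simp
qed

text \<open>Off the countable set \<open>S\<close> the counts of \<open>insert x S\<close> are a
  constant plus an indicator in \<open>x\<close>, and changing a function on a countable set keeps
  it Borel measurable.\<close>

lemma measurable_insert_config:
  assumes S: "S \<in> configurations" 
  shows "(\<lambda>x. insert x S) \<in> borel \<rightarrow>\<^sub>M config_space"
proof (rule measurable_into_config_space)
  show "insert x S \<in> configurations" for x using S by (rule insert_configurations)
  fix B :: "'a set" assume B [measurable]: "B \<in> sets borel"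
  show "(\<lambda>x. emeasure (dirac_sum (insert x S)) B) \<in> borel_measurable borel"
  proof (rule measurable_discrete_difference[where X = S])
    show "(\<lambda>x. emeasure (dirac_sum S) B + of_bool (x \<in> B)) \<in> borel_measurable borel"
      by measurable
  qed (use S B in \<open>auto simp: configurations_countable emeasure_dirac_sum_insert\<close>)
qed

section \<open>Cylinder events and the atoms of finite families of sets\<close>

definition cylinder :: "'a::metric_space set set \<Rightarrow> ('a set \<Rightarrow> ennreal set) \<Rightarrow> 'a set set" where
  "cylinder \<B> C = {S \<in> configurations. \<forall>B\<in>\<B>. emeasure (dirac_sum S) B \<in> C B}"

definition cylinders :: "'a::metric_space set set set" where
  "cylinders = {cylinder \<B> C | \<B> C. finite \<B> \<and> \<B> \<subseteq> sets borel \<and> (\<forall>B. C B \<in> sets borel)}"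

text \<open>Constraints are indexed by the set that they concern, so two cylinders intersect by
  merging their constraints on shared sets and imposing \<open>UNIV\<close> elsewhere.\<close>

lemma Int_stable_cylinders: "Int_stable cylinders"
proof (rule Int_stableI)
  fix a b :: "'a set set" assume "a \<in> cylinders" "b \<in> cylinders"
  then obtain \<B> C \<B>' C' where a: "a = cylinder \<B> C" "finite \<B>" "\<B> \<subseteq> sets borel" "\<forall>B. C B \<in> sets borel"
    and b: "b = cylinder \<B>' C'" "finite \<B>'" "\<B>' \<subseteq> sets borel" "\<forall>B. C' B \<in> sets borel"
    unfolding cylinders_def by blast
  define D where "D B = (if B \<in> \<B> then C B else UNIV) \<inter> (if B \<in> \<B>' then C' B else UNIV)" for B
  have "a \<inter> b = cylinder (\<B> \<union> \<B>') D"
    unfolding a b cylinder_def D_def by auto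
  moreover have "\<forall>B. D B \<in> sets borel"
    using a b by (auto simp: D_def)
  ultimately show "a \<inter> b \<in> cylinders"
    using a b unfolding cylinders_def by blast
qed

lemma sets_config_space_cylinders:
  "sets (config_space :: 'a::metric_space set measure) = sigma_sets configurations cylinders"
proof (rule antisym)
  show "sets (config_space :: 'a set measure) \<subseteq> sigma_sets configurations cylinders"
    unfolding sets_config_space
  proof (rule sigma_sets_mono', rule UN_least, rule subsetI)
    fix B :: "'a set" and A assume B: "B \<in> sets borel"
      and "A \<in> {(\<lambda>S. emeasure (dirac_sum S) B) -` C \<inter> configurations | C. C \<in> sets borel}"
    then obtain C where C: "C \<in> sets borel"
      and A: "A = (\<lambda>S. emeasure (dirac_sum S) B) -` C \<inter> configurations" by auto
    have "A = cylinder {B} (\<lambda>_. C)"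
      unfolding A cylinder_def by auto
    then show "A \<in> cylinders"
      using B C unfolding cylinders_def by blast
  qed
  show "sigma_sets configurations cylinders \<subseteq> sets (config_space :: 'a set measure)"
  proof -
    have "cylinder \<B> C \<in> sets config_space"
      if "finite \<B>" "\<B> \<subseteq> sets borel" "\<forall>B. C B \<in> sets borel" for \<B> and C :: "'a set \<Rightarrow> _"
    proof -
      have [measurable]: "C B \<in> sets borel" for B using that by auto
      have "{S \<in> space config_space. \<forall>B\<in>\<B>. emeasure (dirac_sum S) B \<in> C B} \<in> sets config_space"
      proof (rule sets.sets_Collect_finite_All[OF _ \<open>finite \<B>\<close>])
        fix B assume "B \<in> \<B>"
        with that have [measurable]: "B \<in> sets borel" by auto
        show "{S \<in> space config_space. emeasure (dirac_sum S) B \<in> C B} \<in> sets config_space"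
          by measurable
      qed
      then show ?thesis by (simp add: cylinder_def space_config_space)
    qed
    then show ?thesis
      using sets.sigma_sets_subset[of cylinders config_space]
      by (auto simp: cylinders_def space_config_space)
  qed
qed

lemma cylinders_subset: "cylinders \<subseteq> Pow configurations"
  by (auto simp: cylinders_def cylinder_def)

text \<open>A cell of the partition generated by the family: \<open>\<J>\<close> prescribes which
  members contain the point. Some cells may be empty.\<close>

definition atom :: "'a set set \<Rightarrow> 'a set set \<Rightarrow> 'a set" where
  "atom \<B> \<J> = {x. \<forall>B\<in>\<B>. x \<in> B \<longleftrightarrow> B \<in> \<J>}"

lemma atom_borel:
  assumes "finite \<B>" "\<B> \<subseteq> sets borel"
  shows "atom \<B> \<J> \<in> sets (borel :: 'a::metric_space measure)"
proof -
  have "{x \<in> space borel. \<forall>B\<in>\<B>. x \<in> B \<longleftrightarrow> B \<in> \<J>} \<in> sets (borel :: 'a measure)"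
  proof (rule sets.sets_Collect_finite_All[OF _ assms(1)])
    fix B assume "B \<in> \<B>"
    with assms(2) have [measurable]: "B \<in> sets borel" by auto
    show "{x \<in> space borel. x \<in> B \<longleftrightarrow> B \<in> \<J>} \<in> sets (borel :: 'a measure)" by measurable
  qed
  then show ?thesis by (simp add: atom_def)
qed

text \<open>A condition that sees \<open>x\<close> only through its memberships is constant on each
  atom. When the condition also depends on a configuration, this separates the two variables: the
  measure of the \<open>x\<close>-section is a finite sum of atom masses times indicators in the
  configuration.\<close>

lemma emeasure_atoms:
  fixes M :: "'a::metric_space measure"
  assumes "sets M = sets borel" "finite \<B>" "\<B> \<subseteq> sets borel" "R \<in> sets borel"
  shows "emeasure M {x\<in>R. \<forall>B\<in>\<B>. P B (x \<in> B)} =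
    (\<Sum>\<J>\<in>Pow \<B>. emeasure M (R \<inter> atom \<B> \<J>) * of_bool (\<forall>B\<in>\<B>. P B (B \<in> \<J>)))"
proof -
  let ?T = "\<lambda>\<J>. if \<forall>B\<in>\<B>. P B (B \<in> \<J>) then R \<inter> atom \<B> \<J> else {}"
  have T: "?T \<J> \<in> sets M" for \<J> using assms by (auto intro: atom_borel)
  have "{x\<in>R. \<forall>B\<in>\<B>. P B (x \<in> B)} = (\<Union>\<J>\<in>Pow \<B>. ?T \<J>)"
  proof (rule set_eqI)
    fix x
    have iff: "(\<forall>B\<in>\<B>. P B (B \<in> {B\<in>\<B>. x \<in> B})) \<longleftrightarrow> (\<forall>B\<in>\<B>. P B (x \<in> B))" by auto
    have "x \<in> atom \<B> {B\<in>\<B>. x \<in> B}" by (auto simp: atom_def)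
    then have 1: "x \<in> R \<Longrightarrow> \<forall>B\<in>\<B>. P B (x \<in> B) \<Longrightarrow> x \<in> ?T {B\<in>\<B>. x \<in> B}"
      unfolding iff by auto
    have 2: "\<forall>B\<in>\<B>. P B (x \<in> B)" if "\<forall>B\<in>\<B>. P B (B \<in> \<J>)" "x \<in> atom \<B> \<J>" for \<J>
      using that by (auto simp: atom_def)
    show "x \<in> {x\<in>R. \<forall>B\<in>\<B>. P B (x \<in> B)} \<longleftrightarrow> x \<in> (\<Union>\<J>\<in>Pow \<B>. ?T \<J>)"
    proof
      assume "x \<in> {x\<in>R. \<forall>B\<in>\<B>. P B (x \<in> B)}"
      then have "x \<in> ?T {B\<in>\<B>. x \<in> B}" using 1 by blast
      moreover have "{B\<in>\<B>. x \<in> B} \<in> Pow \<B>" by auto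
      ultimately show "x \<in> (\<Union>\<J>\<in>Pow \<B>. ?T \<J>)" by blast
    next
      assume "x \<in> (\<Union>\<J>\<in>Pow \<B>. ?T \<J>)"
      then show "x \<in> {x\<in>R. \<forall>B\<in>\<B>. P B (x \<in> B)}" using 2 by (auto split: if_splits)
    qed
  qed
  moreover have disj: "disjoint_family_on ?T (Pow \<B>)"
    unfolding disjoint_family_on_def atom_def
    by (auto split: if_splits)
  ultimately have "emeasure M {x\<in>R. \<forall>B\<in>\<B>. P B (x \<in> B)} = emeasure M (\<Union>\<J>\<in>Pow \<B>. ?T \<J>)"
    by simp
  also have "\<dots> = (\<Sum>\<J>\<in>Pow \<B>. emeasure M (?T \<J>))"
    using T assms(2) disj by (intro sum_emeasure[symmetric] image_subsetI) auto
  finally have "emeasure M {x\<in>R. \<forall>B\<in>\<B>. P B (x \<in> B)} = (\<Sum>\<J>\<in>Pow \<B>. emeasure M (?T \<J>))" .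
  then show ?thesis
    by (auto intro!: sum.cong)
qed

subsection \<open>Adding and removing points\<close>

lemma configurations_subset_borel:
  "S \<in> configurations \<Longrightarrow> T \<subseteq> S \<Longrightarrow> T \<in> sets borel"
  by (auto intro: borel_countable countable_subset dest: configurations_countable)

lemma insert_preimage_borel:
  assumes "S \<in> configurations" "A \<in> sets config_space"
  shows "{x. insert x S \<in> A} \<in> sets borel"
  using measurable_sets[OF measurable_insert_config[OF assms(1)] assms(2)] by (simp add: vimage_def)

text \<open>Serves both shifts of the counts: \<open>f b\<close> is later addition or subtraction of
  \<open>of_bool b\<close>, and \<open>Q B\<close> tells whether the atom of the moved point lies in
  \<open>B\<close>.\<close>

lemma measurable_cylinder_shift:
  assumes "finite \<B>" "\<B> \<subseteq> sets borel" "\<And>B. C B \<in> sets borel"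
    and "\<And>b. f b \<in> borel_measurable borel"
  shows "(\<lambda>S. of_bool (\<forall>B\<in>\<B>. f (Q B) (emeasure (dirac_sum S) B) \<in> C B) :: ennreal) \<in> borel_measurable config_space"
proof -
  have "Measurable.pred config_space (\<lambda>S. \<forall>B\<in>\<B>. f (Q B) (emeasure (dirac_sum S) B) \<in> C B)"
  proof (rule pred_intros_finite(3)[OF assms(1)])
    fix B assume "B \<in> \<B>"
    with assms have [measurable]: "B \<in> sets borel" "C B \<in> sets borel" "f (Q B) \<in> borel_measurable borel" by auto
    show "Measurable.pred config_space (\<lambda>S. f (Q B) (emeasure (dirac_sum S) B) \<in> C B)"
      by measurable
  qed
  then show ?thesis by measurable
qed

text \<open>Dynkin's theorem for the cylinders: only disjoint unions have to be treated, and on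
  these the masses below are additive.\<close>

lemma config_induct [consumes 1, case_names basic empty compl union]:
  assumes "A \<in> sets config_space"
    and "\<And>\<B> C. finite \<B> \<Longrightarrow> \<B> \<subseteq> sets borel \<Longrightarrow> (\<And>B. C B \<in> sets borel) \<Longrightarrow> P (cylinder \<B> C)"
    and "P {}"
    and "\<And>A. A \<in> sets config_space \<Longrightarrow> P A \<Longrightarrow> P (configurations - A)"
    and "\<And>A. disjoint_family A \<Longrightarrow> range A \<subseteq> sets config_space \<Longrightarrow> (\<And>i. P (A i)) \<Longrightarrow> P (\<Union>i::nat. A i)"
  shows "P A"
  using Int_stable_cylinders cylinders_subset assms(1)[unfolded sets_config_space_cylinders]
proof (induction A rule: sigma_sets_induct_disjoint)
  case (basic A)
  then show ?case using assms(2) unfolding cylinders_def by blast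
qed (use assms in \<open>auto simp: sets_config_space_cylinders\<close>)

text \<open>
  Since \<open>X\<close> need not be separable, \<open>{(x, S). x \<in> S}\<close> may fail to be measurable in the product
  \<open>\<sigma>\<close>-algebra, and so may the map \<open>(x, S) \<mapsto> insert x S\<close>. Measurability in \<open>S\<close> after integrating
  out \<open>x\<close> is therefore obtained from the cylinder events by a Dynkin argument instead of Fubini.
\<close>

lemma measurable_emeasure_insert:
  fixes \<sigma> :: "'a::metric_space measure"
  assumes sets: "sets \<sigma> = sets borel" and fin: "finite_measure \<sigma>"
    and diffuse: "\<And>x. emeasure \<sigma> {x} = 0" and A: "A \<in> sets config_space"
  shows "(\<lambda>S. emeasure \<sigma> {x. insert x S \<in> A}) \<in> borel_measurable config_space"
  using A
proof (induction A rule: config_induct)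
  interpret finite_measure \<sigma> by fact
  have space: "space \<sigma> = UNIV" using sets_eq_imp_space_eq[OF sets] by simp
  {
    case (basic \<B> C)
    have A: "cylinder \<B> C \<in> sets config_space"
      unfolding sets_config_space_cylinders
      using basic by (intro sigma_sets.Basic) (auto simp: cylinders_def)
    let ?f = "\<lambda>S. \<Sum>\<J>\<in>Pow \<B>. emeasure \<sigma> (UNIV \<inter> atom \<B> \<J>) *
      of_bool (\<forall>B\<in>\<B>. emeasure (dirac_sum S) B + of_bool (B \<in> \<J>) \<in> C B)"
    have "emeasure \<sigma> {x. insert x S \<in> cylinder \<B> C} = ?f S" if S: "S \<in> configurations" for S
    proof -
      let ?E = "{x\<in>UNIV. \<forall>B\<in>\<B>. emeasure (dirac_sum S) B + of_bool (x \<in> B) \<in> C B}"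
      have diff: "x \<in> ?E \<longleftrightarrow> insert x S \<in> cylinder \<B> C" if "x \<notin> S" for x
      proof -
        have "emeasure (dirac_sum (insert x S)) B = emeasure (dirac_sum S) B + of_bool (x \<in> B)"
          if "B \<in> \<B>" for B
          using \<open>B \<in> \<B>\<close> \<open>x \<notin> S\<close> basic by (intro emeasure_dirac_sum_insert) auto
        then show ?thesis
          using S by (auto simp: cylinder_def insert_configurations)
      qed
      have 1: "{x. insert x S \<in> cylinder \<B> C} \<in> sets \<sigma>"
        using insert_preimage_borel[OF S A] sets by simp
      have 2: "?E \<in> sets \<sigma>"
      proof -
        have "{x\<in>space borel. \<forall>B\<in>\<B>. emeasure (dirac_sum S) B + of_bool (x \<in> B) \<in> C B} \<in> sets borel"
        proof (rule sets.sets_Collect_finite_All[OF _ basic(1)])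
          fix B assume "B \<in> \<B>"
          with basic have [measurable]: "B \<in> sets borel" "C B \<in> sets borel" by auto
          show "{x\<in>space borel. emeasure (dirac_sum S) B + of_bool (x \<in> B) \<in> C B} \<in> sets borel"
            by measurable
        qed
        then show ?thesis using sets by simp
      qed
      \<comment> \<open>Diffuseness enters here: adding a point of \<open>S\<close> changes no
        count, but such points form a countable, hence null, set.\<close>
      have "AE x in \<sigma>. x \<notin> S"
        using sets by (intro AE_discrete_difference) (auto simp: configurations_countable S diffuse)
      then have "AE x in \<sigma>. x \<in> {x. insert x S \<in> cylinder \<B> C} \<longleftrightarrow> x \<in> ?E"
        by eventually_elim (use diff in blast)
      then have "emeasure \<sigma> {x. insert x S \<in> cylinder \<B> C} = emeasure \<sigma> ?E"
        by (rule emeasure_eq_AE[OF _ 1 2])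
      also have "\<dots> = ?f S"
        by (rule emeasure_atoms) (use basic sets in auto)
      finally show ?thesis .
    qed
    moreover have "?f \<in> borel_measurable config_space"
      using measurable_cylinder_shift[where f = "\<lambda>b n. n + of_bool b", OF basic]
      by (intro borel_measurable_sum borel_measurable_times) auto
    ultimately show ?case
      by (subst measurable_cong) (auto simp: space_config_space)
  next
    case empty
    show ?case by simp
  next
    case (compl A)
    have "emeasure \<sigma> {x. insert x S \<in> configurations - A} = emeasure \<sigma> UNIV - emeasure \<sigma> {x. insert x S \<in> A}"
      if S: "S \<in> configurations" for S
    proof -
      have "{x. insert x S \<in> configurations - A} = space \<sigma> - {x. insert x S \<in> A}"
        using S space by (auto simp: insert_configurations)
      then show ?thesis
        using emeasure_compl[of "{x. insert x S \<in> A}" \<sigma>] insert_preimage_borel[OF S compl(1)] sets space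
        by simp
    qed
    moreover have "(\<lambda>S. emeasure \<sigma> UNIV - emeasure \<sigma> {x. insert x S \<in> A}) \<in> borel_measurable config_space"
      using compl(2) by measurable
    ultimately show ?case
      by (subst measurable_cong) (simp_all only: space_config_space)
  next
    case (union A)
    have "emeasure \<sigma> {x. insert x S \<in> (\<Union>i. A i)} = (\<Sum>i. emeasure \<sigma> {x. insert x S \<in> A i})"
      if S: "S \<in> configurations" for S
    proof -
      have "{x. insert x S \<in> A i} \<in> sets \<sigma>" for i
        using insert_preimage_borel[OF S, of "A i"] union(2) sets by auto
      then have "(\<Sum>i. emeasure \<sigma> {x. insert x S \<in> A i}) = emeasure \<sigma> (\<Union>i. {x. insert x S \<in> A i})"
        using union(1) by (intro suminf_emeasure) (auto simp: disjoint_family_on_def)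
      also have "(\<Union>i. {x. insert x S \<in> A i}) = {x. insert x S \<in> (\<Union>i. A i)}" by auto
      finally show ?thesis by simp
    qed
    then show ?case using union(3)
      by (subst measurable_cong) (auto simp: space_config_space)
  }
qed

text \<open>The complement step of the Dynkin argument subtracts from the count of \<open>R\<close>,
  which is legitimate only when that count is finite; hence the restriction to \<open>R\<close> and
  the value 0 otherwise.\<close>

lemma measurable_emeasure_remove:
  assumes A: "A \<in> sets config_space" and R: "R \<in> sets borel"
  shows "(\<lambda>S. if emeasure (dirac_sum S) R < \<infinity>
              then emeasure (dirac_sum S) {x\<in>R. x \<in> S \<and> S - {x} \<in> A} else 0)
         \<in> borel_measurable config_space"
  using A
proof (induction A rule: config_induct)
  note [measurable] = R
  have meas: "{x\<in>R. x \<in> S \<and> S - {x} \<in> A} \<in> sets (dirac_sum S)" if "S \<in> configurations" for S A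
    using configurations_subset_borel[OF that, of "{x\<in>R. x \<in> S \<and> S - {x} \<in> A}"] by auto
  {
    case (basic \<B> C)
    let ?f = "\<lambda>S. \<Sum>\<J>\<in>Pow \<B>. emeasure (dirac_sum S) (R \<inter> atom \<B> \<J>) *
      of_bool (\<forall>B\<in>\<B>. emeasure (dirac_sum S) B - of_bool (B \<in> \<J>) \<in> C B)"
    have "emeasure (dirac_sum S) {x\<in>R. x \<in> S \<and> S - {x} \<in> cylinder \<B> C} = ?f S"
      if S: "S \<in> configurations" for S
    proof -
      let ?E = "{x\<in>R. \<forall>B\<in>\<B>. emeasure (dirac_sum S) B - of_bool (x \<in> B) \<in> C B}"
      have 2: "?E \<in> sets (dirac_sum S)"
      proof -
        have "{x\<in>space borel. x \<in> R \<and> (\<forall>B\<in>\<B>. emeasure (dirac_sum S) B - of_bool (x \<in> B) \<in> C B)} \<in> sets borel"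
        proof (intro sets.sets_Collect_conj sets.sets_Collect_finite_All[OF _ basic(1)])
          fix B assume "B \<in> \<B>"
          with basic have [measurable]: "B \<in> sets borel" "C B \<in> sets borel" by auto
          show "{x\<in>space borel. emeasure (dirac_sum S) B - of_bool (x \<in> B) \<in> C B} \<in> sets borel"
            by measurable
        qed measurable
        then show ?thesis by simp
      qed
      have "S \<inter> {x\<in>R. x \<in> S \<and> S - {x} \<in> cylinder \<B> C} = S \<inter> ?E"
      proof -
        have "emeasure (dirac_sum (S - {x})) B = emeasure (dirac_sum S) B - of_bool (x \<in> B)"
          if "B \<in> \<B>" "x \<in> S" for B x
          using that basic by (intro emeasure_dirac_sum_remove) auto
        then show ?thesis
          using S by (auto simp: cylinder_def Diff_configurations)
      qed
      then have "emeasure (dirac_sum S) {x\<in>R. x \<in> S \<and> S - {x} \<in> cylinder \<B> C} = emeasure (dirac_sum S) ?E"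
        using 2 meas[OF S, of "cylinder \<B> C"] by (simp add: emeasure_dirac_sum)
      also have "\<dots> = ?f S"
        by (rule emeasure_atoms) (use basic in auto)
      finally show ?thesis .
    qed
    moreover have "?f \<in> borel_measurable config_space"
      using measurable_cylinder_shift[where f = "\<lambda>b n. n - of_bool b", OF basic] atom_borel[OF basic(1,2)]
      by (intro borel_measurable_sum borel_measurable_times measurable_count) auto
    then have "(\<lambda>S. if emeasure (dirac_sum S) R < \<infinity> then ?f S else 0) \<in> borel_measurable config_space"
      by measurable
    ultimately show ?case
      by (subst measurable_cong) (auto simp: space_config_space)
  next
    case empty
    show ?case by (simp cong: if_cong)
  next
    case (compl A)
    have "emeasure (dirac_sum S) {x\<in>R. x \<in> S \<and> S - {x} \<in> configurations - A} =
      emeasure (dirac_sum S) R - emeasure (dirac_sum S) {x\<in>R. x \<in> S \<and> S - {x} \<in> A}"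
      if S: "S \<in> configurations" and fin: "emeasure (dirac_sum S) R < \<infinity>" for S
    proof -
      let ?E = "\<lambda>A. {x\<in>R. x \<in> S \<and> S - {x} \<in> A}"
      have "emeasure (dirac_sum S) (?E A) \<le> emeasure (dirac_sum S) R"
        by (intro emeasure_mono) auto
      then have "emeasure (dirac_sum S) (R - ?E A) = emeasure (dirac_sum S) R - emeasure (dirac_sum S) (?E A)"
        using meas[OF S, of A] fin by (intro emeasure_Diff) auto
      moreover have "S \<inter> (R - ?E A) = S \<inter> ?E (configurations - A)"
        using S by (auto simp: Diff_configurations)
      ultimately show ?thesis
        using meas[OF S, of A] meas[OF S, of "configurations - A"]
        by (simp add: emeasure_dirac_sum sets.Diff)
    qed
    note eq = this
    \<comment> \<open>The inner conditional repeats the outer one so that the subtracted function is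
      literally the one from the induction hypothesis.\<close>
    let ?g = "\<lambda>S. if emeasure (dirac_sum S) R < \<infinity> then emeasure (dirac_sum S) R -
      (if emeasure (dirac_sum S) R < \<infinity> then emeasure (dirac_sum S) {x\<in>R. x \<in> S \<and> S - {x} \<in> A} else 0) else 0"
    have "?g \<in> borel_measurable config_space"
      using compl(2) by measurable
    moreover have "(if emeasure (dirac_sum S) R < \<infinity> then
        emeasure (dirac_sum S) {x\<in>R. x \<in> S \<and> S - {x} \<in> configurations - A} else 0) = ?g S"
      if "S \<in> space config_space" for S
      using eq[of S] that unfolding space_config_space
      by (cases "emeasure (dirac_sum S) R < \<infinity>") (simp_all only: if_True if_False simp_thms)
    ultimately show ?case
      by (subst measurable_cong)
  next
    case (union A)
    have "emeasure (dirac_sum S) {x\<in>R. x \<in> S \<and> S - {x} \<in> (\<Union>i. A i)} =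
      (\<Sum>i. emeasure (dirac_sum S) {x\<in>R. x \<in> S \<and> S - {x} \<in> A i})"
      if S: "S \<in> configurations" for S
    proof -
      have "(\<Sum>i. emeasure (dirac_sum S) {x\<in>R. x \<in> S \<and> S - {x} \<in> A i}) =
        emeasure (dirac_sum S) (\<Union>i. {x\<in>R. x \<in> S \<and> S - {x} \<in> A i})"
        using union(1) meas[OF S] by (intro suminf_emeasure) (auto simp: disjoint_family_on_def)
      also have "(\<Union>i. {x\<in>R. x \<in> S \<and> S - {x} \<in> A i}) = {x\<in>R. x \<in> S \<and> S - {x} \<in> (\<Union>i. A i)}" by auto
      finally show ?thesis by simp
    qed
    note eq = this
    let ?g = "\<lambda>S. \<Sum>i. if emeasure (dirac_sum S) R < \<infinity> then
      emeasure (dirac_sum S) {x\<in>R. x \<in> S \<and> S - {x} \<in> A i} else 0"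
    have "?g \<in> borel_measurable config_space"
      using union(3) by measurable
    moreover have "(if emeasure (dirac_sum S) R < \<infinity> then
        emeasure (dirac_sum S) {x\<in>R. x \<in> S \<and> S - {x} \<in> (\<Union>i. A i)} else 0) = ?g S"
      if "S \<in> space config_space" for S
      using eq[of S] that unfolding space_config_space
      by (cases "emeasure (dirac_sum S) R < \<infinity>") (simp_all only: if_True if_False simp_thms suminf_zero)
    ultimately show ?case
      by (subst measurable_cong)
  }
qed

text \<open>
  The Bochner integrals over configurations vanish on integrands that are not measurable, so
  measurability is also needed on the null set of infinite configurations. There the number of
  points with a given property cannot be localised by an exhaustion of \<open>X\<close>. However, an event depends
  on countably many counts only, and removing \<open>x\<close> can only matter if one of these counts is finite
  on a set containing \<open>x\<close>.
\<close>

lemma config_event_determined: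
  fixes A :: "'a::metric_space set set"
  assumes "A \<in> sets config_space"
  shows "\<exists>\<R>. countable \<R> \<and> \<R> \<subseteq> sets borel \<and>
    (\<forall>S\<in>configurations. \<forall>x\<in>S. (\<forall>B\<in>\<R>. x \<in> B \<longrightarrow> emeasure (dirac_sum S) B = \<infinity>) \<longrightarrow>
       (S - {x} \<in> A \<longleftrightarrow> S \<in> A))"
  using assms
proof (induction A rule: config_induct)
  case (basic \<B> C)
  have "S - {x} \<in> cylinder \<B> C \<longleftrightarrow> S \<in> cylinder \<B> C"
    if S: "S \<in> configurations" and x: "x \<in> S"
      and inf: "\<forall>B\<in>\<B>. x \<in> B \<longrightarrow> emeasure (dirac_sum S) B = \<infinity>" for S x
  proof -
    \<comment> \<open>Either \<open>x \<notin> B\<close>, or the count of \<open>B\<close> is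
      infinite and remains so after removing one point.\<close>
    have "emeasure (dirac_sum (S - {x})) B = emeasure (dirac_sum S) B" if "B \<in> \<B>" for B
      using that inf basic(2) x by (cases "x \<in> B") (auto simp: emeasure_dirac_sum_remove subset_eq)
    then show ?thesis
      using S by (auto simp: cylinder_def Diff_configurations)
  qed
  then show ?case
    using basic by (intro exI[of _ \<B>]) (auto simp: countable_finite)
next
  case empty
  show ?case by auto
next
  case (compl A)
  then obtain \<R> where \<R>: "countable \<R>" "\<R> \<subseteq> sets borel"
    "\<forall>S\<in>configurations. \<forall>x\<in>S. (\<forall>B\<in>\<R>. x \<in> B \<longrightarrow> emeasure (dirac_sum S) B = \<infinity>) \<longrightarrow>
       (S - {x} \<in> A \<longleftrightarrow> S \<in> A)" by blast
  then show ?case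
    by (intro exI[of _ \<R>]) (simp add: Diff_configurations)
next
  case (union A)
  then have "\<forall>i. \<exists>\<R>. countable \<R> \<and> \<R> \<subseteq> sets borel \<and>
    (\<forall>S\<in>configurations. \<forall>x\<in>S. (\<forall>B\<in>\<R>. x \<in> B \<longrightarrow> emeasure (dirac_sum S) B = \<infinity>) \<longrightarrow>
       (S - {x} \<in> A i \<longleftrightarrow> S \<in> A i))" by blast
  then obtain \<R> where \<R>: "\<And>i. countable (\<R> i)" "\<And>i. \<R> i \<subseteq> sets borel"
    "\<And>i S x. S \<in> configurations \<Longrightarrow> x \<in> S \<Longrightarrow>
       (\<forall>B\<in>\<R> i. x \<in> B \<longrightarrow> emeasure (dirac_sum S) B = \<infinity>) \<Longrightarrow> S - {x} \<in> A i \<longleftrightarrow> S \<in> A i"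
    by metis
  show ?case
  proof (intro exI[of _ "\<Union>i. \<R> i"] conjI ballI impI)
    show "countable (\<Union>i. \<R> i)" using \<R>(1) by auto
    show "(\<Union>i. \<R> i) \<subseteq> sets borel" using \<R>(2) by auto
    fix S x assume "S \<in> configurations" "x \<in> S"
      "\<forall>B\<in>\<Union>i. \<R> i. x \<in> B \<longrightarrow> emeasure (dirac_sum S) B = \<infinity>"
    then have "S - {x} \<in> A i \<longleftrightarrow> S \<in> A i" for i using \<R>(3)[of S x i] by blast
    then show "S - {x} \<in> (\<Union>i. A i) \<longleftrightarrow> S \<in> (\<Union>i. A i)" by auto
  qed
qed

text \<open>By \<open>config_event_determined\<close>, every point whose removal matters lies in
  some member of a countable family with finite count. Finite unions of such members exhaust these
  points, and on each union \<open>measurable_emeasure_remove\<close> applies.\<close>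

lemma measurable_count_pivotal:
  fixes A :: "'a::metric_space set set"
  assumes A: "A \<in> sets config_space"
  shows "(\<lambda>S. emeasure (dirac_sum S) {x\<in>S. S \<in> A \<and> S - {x} \<notin> A}) \<in> borel_measurable config_space"
proof -
  obtain \<R> where "countable \<R>" "\<R> \<subseteq> sets borel"
    and \<R>: "\<forall>S\<in>configurations. \<forall>x\<in>S. (\<forall>B\<in>\<R>. x \<in> B \<longrightarrow> emeasure (dirac_sum S) B = \<infinity>) \<longrightarrow>
       (S - {x} \<in> A \<longleftrightarrow> S \<in> A)" using config_event_determined[OF A] by blast
  \<comment> \<open>The empty set is added so that the family can be enumerated even if it has no
    members.\<close>
  define r where "r = from_nat_into (insert {} \<R>)"
  have r: "range r = insert {} \<R>"
    unfolding r_def using \<open>countable \<R>\<close> by (intro range_from_nat_into) auto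
  have rb: "r i \<in> sets borel" for i
    using r \<open>\<R> \<subseteq> sets borel\<close> by (metis insert_subset range_subsetD sets.empty_sets)
  define U where "U I = (\<Union>i\<in>I. r i)" for I
  have Ub: "finite I \<Longrightarrow> U I \<in> sets borel" for I
    using rb by (auto simp: U_def)
  let ?E = "\<lambda>S I. {x\<in>U I. x \<in> S \<and> S - {x} \<in> configurations - A}"
  let ?H = "\<lambda>S I. if emeasure (dirac_sum S) (U I) < \<infinity> then emeasure (dirac_sum S) (?E S I) else 0"
  have eq: "emeasure (dirac_sum S) {x\<in>S. S \<in> A \<and> S - {x} \<notin> A} = indicator A S * (SUP I\<in>{I. finite I}. ?H S I)"
    if S: "S \<in> configurations" for S
  proof (cases "S \<in> A")
    case True
    have meas: "T \<in> sets (dirac_sum S)" if "T \<subseteq> S" for T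
      using configurations_subset_borel[OF S that] by simp
    \<comment> \<open>The index sets that exhaust the pivotal points depend on \<open>S\<close>. To
      obtain a measurable expression, the supremum is later taken over all finite index sets; those
      with infinite count contribute 0 to it.\<close>
    define I where "I n = {i. i < n \<and> emeasure (dirac_sum S) (r i) < \<infinity>}" for n :: nat
    have "emeasure (dirac_sum S) {x\<in>S. S - {x} \<notin> A} = (SUP n. emeasure (dirac_sum S) (?E S (I n)))"
    proof -
      have "{x\<in>S. S - {x} \<notin> A} = (\<Union>n. ?E S (I n))"
      proof (intro equalityI subsetI)
        fix x assume x: "x \<in> {x\<in>S. S - {x} \<notin> A}"
        then obtain B where "B \<in> \<R>" "x \<in> B" "emeasure (dirac_sum S) B \<noteq> \<infinity>"
          using \<R> S True by auto
        moreover then obtain i where "B = r i" using r by blast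
        ultimately have "x \<in> U (I (Suc i))"
          by (auto simp: U_def I_def top.not_eq_extremum)
        then show "x \<in> (\<Union>n. ?E S (I n))"
          using x S by (auto simp: Diff_configurations)
      qed auto
      moreover have "incseq (\<lambda>n. ?E S (I n))"
        by (rule incseq_SucI) (auto simp: U_def I_def intro: less_SucI)
      moreover have "range (\<lambda>n. ?E S (I n)) \<subseteq> sets (dirac_sum S)"
        by (intro image_subsetI meas) auto
      ultimately show ?thesis
        by (simp only: SUP_emeasure_incseq)
    qed
    also have "\<dots> = (SUP n. ?H S (I n))"
    proof -
      have "emeasure (dirac_sum S) (U (I n)) < \<infinity>" for n
      proof -
        have "finite (I n)" by (simp add: I_def)
        moreover have "finite (S \<inter> r i)" if "i \<in> I n" for i
          using that emeasure_dirac_sum_less_top_iff[OF rb, of S i] by (simp add: I_def)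
        ultimately have "finite (\<Union>i\<in>I n. S \<inter> r i)" by blast
        also have "(\<Union>i\<in>I n. S \<inter> r i) = S \<inter> U (I n)" by (auto simp: U_def)
        finally show ?thesis
          using emeasure_dirac_sum_less_top_iff[OF Ub[OF \<open>finite (I n)\<close>]] by blast
      qed
      then show ?thesis by simp
    qed
    also have "\<dots> \<le> (SUP I\<in>{I. finite I}. ?H S I)"
      by (intro SUP_mono) (auto simp: I_def intro!: exI[of _ "I _"])
    finally have "emeasure (dirac_sum S) {x\<in>S. S - {x} \<notin> A} \<le> (SUP I\<in>{I. finite I}. ?H S I)" .
    moreover have "(SUP I\<in>{I. finite I}. ?H S I) \<le> emeasure (dirac_sum S) {x\<in>S. S - {x} \<notin> A}"
    proof (rule SUP_least)
      show "?H S I \<le> emeasure (dirac_sum S) {x\<in>S. S - {x} \<notin> A}" for I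
        using meas[of "{x\<in>S. S - {x} \<notin> A}"] by (auto intro!: emeasure_mono)
    qed
    ultimately show ?thesis using True by simp
  qed simp
  have "countable {I :: nat set. finite I}"
    using countable_Collect_finite by auto
  moreover have "(\<lambda>S. ?H S I) \<in> borel_measurable config_space" if "finite I" for I
    using A Ub[OF that] sets.top[of config_space]
    by (intro measurable_emeasure_remove sets.Diff) (auto simp: space_config_space)
  ultimately have "(\<lambda>S. indicator A S * (SUP I\<in>{I. finite I}. ?H S I)) \<in> borel_measurable config_space"
    using A by (intro borel_measurable_times_ennreal borel_measurable_SUP borel_measurable_indicator) auto
  then show ?thesis
    by (subst measurable_cong[OF eq]) (auto simp: space_config_space)
qed

subsection \<open>Finite configurations\<close>

definition finite_configs :: "'a set set" where
  "finite_configs = {S. finite S}"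

text \<open>
  A map \<open>f\<close> into finitely many labels encodes a finite Borel partition of \<open>X\<close>; the multiset of labels
  of a finite configuration records the counts in all cells at once, and events for two
  partitions are events for the common refinement.
\<close>

definition labels :: "('a \<Rightarrow> nat) \<Rightarrow> 'a set \<Rightarrow> nat multiset" where
  "labels f S = image_mset f (mset_set S)"

definition label_events :: "'a::metric_space set set set" where
  "label_events = {{S \<in> finite_configs. labels f S \<in> K} | f K.
     f \<in> borel \<rightarrow>\<^sub>M count_space UNIV \<and> finite (range f)}"

lemma countable_UNIV_multiset: "countable (UNIV :: 'a::countable multiset set)"
proof -
  have "(UNIV :: 'a multiset set) = range mset" by (simp add: surj_mset)
  then show ?thesis by (metis countable_image countableI_type)
qed

lemma count_labels: "finite S \<Longrightarrow> count (labels f S) i = card (S \<inter> f -` {i})"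
  by (simp add: labels_def count_image_mset Int_commute)

lemma size_labels [simp]: "size (labels f S) = card S"
  by (simp add: labels_def)

lemma labels_insert: "finite S \<Longrightarrow> x \<notin> S \<Longrightarrow> labels f (insert x S) = add_mset (f x) (labels f S)"
  by (simp add: labels_def)

lemma labels_remove: "finite S \<Longrightarrow> x \<in> S \<Longrightarrow> labels f (S - {x}) = labels f S - {#f x#}"
  using labels_insert[of "S - {x}" x f] by (simp add: insert_absorb)

lemma set_labels: "finite S \<Longrightarrow> set_mset (labels f S) = f ` S"
  by (simp add: labels_def)

lemma labels_comp: "labels (g \<circ> f) S = image_mset g (labels f S)"
  by (simp add: labels_def multiset.map_comp)

lemma label_events_subset: "label_events \<subseteq> Pow finite_configs"
  by (auto simp: label_events_def)

lemma label_events_common: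
  fixes A B :: "'a::metric_space set set"
  assumes "A \<in> label_events" "B \<in> label_events"
  obtains h n K L where "h \<in> borel \<rightarrow>\<^sub>M count_space UNIV" "\<And>x. h x < n"
    "A = {S \<in> finite_configs. labels h S \<in> K}" "B = {S \<in> finite_configs. labels h S \<in> L}"
proof -
  obtain f K where f: "f \<in> borel \<rightarrow>\<^sub>M count_space UNIV" "finite (range f)"
    and A: "A = {S \<in> finite_configs. labels f S \<in> K}"
    using assms(1) unfolding label_events_def by blast
  obtain g L where g: "g \<in> borel \<rightarrow>\<^sub>M count_space UNIV" "finite (range g)"
    and B: "B = {S \<in> finite_configs. labels g S \<in> L}"
    using assms(2) unfolding label_events_def by blast
  \<comment> \<open>Pairing the labels gives the common refinement; the two projections recover the
    original label multisets as images.\<close>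
  define h where "h x = prod_encode (f x, g x)" for x
  have "h \<in> borel \<rightarrow>\<^sub>M count_space UNIV"
  proof (rule measurable_count_space_eq2_countable[THEN iffD2])
    show "h \<in> space borel \<rightarrow> UNIV \<and> (\<forall>a\<in>UNIV. h -` {a} \<inter> space borel \<in> sets borel)"
    proof (intro conjI ballI)
      fix a :: nat
      obtain u v where uv: "prod_decode a = (u, v)" by force
      have "h x = a \<longleftrightarrow> f x = u \<and> g x = v" for x
        using uv unfolding h_def by (metis prod_decode_inverse prod_encode_inverse prod.inject)
      then have "h -` {a} \<inter> space borel = (f -` {u} \<inter> space borel) \<inter> (g -` {v} \<inter> space borel)"
        by auto
      then show "h -` {a} \<inter> space borel \<in> sets borel"
        using measurable_sets[OF f(1), of "{u}"] measurable_sets[OF g(1), of "{v}"] by auto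
    qed auto
  qed
  moreover
  have "finite (range h)"
  proof (rule finite_subset)
    show "range h \<subseteq> prod_encode ` (range f \<times> range g)" by (auto simp: h_def)
  qed (use f g in auto)
  then obtain n where "\<And>x. h x < n"
    by (metis finite_nat_set_iff_bounded rangeI)
  moreover have fh: "f = (fst \<circ> prod_decode) \<circ> h" and gh: "g = (snd \<circ> prod_decode) \<circ> h"
    by (auto simp: h_def)
  have "A = {S \<in> finite_configs. labels h S \<in> image_mset (fst \<circ> prod_decode) -` K}"
    unfolding A by (subst fh) (simp add: labels_comp del: comp_apply)
  moreover have "B = {S \<in> finite_configs. labels h S \<in> image_mset (snd \<circ> prod_decode) -` L}"
    unfolding B by (subst gh) (simp add: labels_comp del: comp_apply)
  ultimately show ?thesis using that by blast
qed

lemma label_eventsI: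
  "h \<in> borel \<rightarrow>\<^sub>M count_space UNIV \<Longrightarrow> (\<And>x. h x < n) \<Longrightarrow>
    {S \<in> finite_configs. labels h S \<in> K} \<in> label_events"
  unfolding label_events_def
  by (auto intro!: exI[of _ h] exI[of _ K] finite_subset[of "range h" "{..<n}"])

lemma label_eventsE:
  assumes "A \<in> label_events"
  obtains f n K where "f \<in> borel \<rightarrow>\<^sub>M count_space UNIV" "\<And>x. f x < n"
    "A = {S \<in> finite_configs. labels f S \<in> K}"
proof -
  from assms obtain f K where f: "f \<in> borel \<rightarrow>\<^sub>M count_space UNIV" "finite (range f)"
    and A: "A = {S \<in> finite_configs. labels f S \<in> K}"
    unfolding label_events_def by blast
  from f(2) obtain n where "\<And>x. f x < n"
    by (metis finite_nat_set_iff_bounded rangeI)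
  then show ?thesis using that f(1) A by blast
qed

lemma Int_stable_label_events: "Int_stable label_events"
proof (rule Int_stableI)
  fix A B :: "'a set set" assume "A \<in> label_events" "B \<in> label_events"
  then obtain h n K L where h: "h \<in> borel \<rightarrow>\<^sub>M count_space UNIV" "\<And>x. h x < n"
    "A = {S \<in> finite_configs. labels h S \<in> K}" "B = {S \<in> finite_configs. labels h S \<in> L}"
    by (rule label_events_common) blast
  then have "A \<inter> B = {S \<in> finite_configs. labels h S \<in> K \<inter> L}" by auto
  moreover have "\<dots> \<in> label_events" by (rule label_eventsI[OF h(1,2)])
  ultimately show "A \<inter> B \<in> label_events" by simp
qed

text \<open>A single cell suffices. The generator has to contain the whole space so that total
  masses can be compared in \<open>countably_additive_eqI\<close>.\<close>

lemma finite_configs_label_events: "finite_configs \<in> label_events"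
  using label_eventsI[of "\<lambda>_. 0" 1 UNIV] by (simp add: finite_configs_def)

lemma finite_configs_subset: "finite_configs \<subseteq> configurations"
  by (auto simp: finite_configs_def finite_configurations)

lemma finite_configs_eq:
  "finite_configs =  {S :: 'a::metric_space set. S \<in> configurations \<and> emeasure (dirac_sum S) UNIV < \<infinity>}"
proof -
  have "emeasure (dirac_sum S) UNIV < \<infinity> \<longleftrightarrow> finite S" for S :: "'a set"
    using emeasure_dirac_sum_less_top_iff[of UNIV S] by simp
  then show ?thesis
    using finite_configurations unfolding finite_configs_def by blast
qed

lemma sets_finite_configs: "finite_configs \<in> sets config_space"
proof -
  have "{S \<in> space config_space. emeasure (dirac_sum S) UNIV < \<infinity>} \<in> sets config_space"
    by measurable
  then show ?thesis by (simp add: finite_configs_eq space_config_space)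
qed

text \<open>Finitely many cells cover the space, so finite counts in all of them force the
  configuration to be finite. This rewrites a level set of \<open>labels\<close> as an intersection
  of count events, to which independence applies.\<close>

lemma labels_level:
  assumes "\<And>x. f x < n" "f \<in> borel \<rightarrow>\<^sub>M count_space UNIV" "set_mset M \<subseteq> {..<n}"
  shows "{S \<in> finite_configs. labels f S = M} =
    {S \<in> configurations. \<forall>i<n. emeasure (dirac_sum S) (f -` {i}) = of_nat (count M i)}"
proof -
  have b: "f -` {i} \<in> sets borel" for i
    using measurable_sets[OF assms(2), of "{i}"] by simp
  show ?thesis
  proof (intro equalityI subsetI)
    fix S assume "S \<in> {S \<in> finite_configs. labels f S = M}"
    then show "S \<in> {S \<in> configurations. \<forall>i<n. emeasure (dirac_sum S) (f -` {i}) = of_nat (count M i)}"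
      using b by (auto simp: finite_configs_def finite_configurations emeasure_dirac_sum_finite count_labels)
  next
    fix S assume S: "S \<in> {S \<in> configurations. \<forall>i<n. emeasure (dirac_sum S) (f -` {i}) = of_nat (count M i)}"
    then have "finite (S \<inter> f -` {i})" if "i < n" for i
      using emeasure_dirac_sum_less_top_iff[OF b, of S i] that by (simp add: of_nat_less_top)
    then have "finite (\<Union>i<n. S \<inter> f -` {i})" by blast
    also have "(\<Union>i<n. S \<inter> f -` {i}) = S" using assms(1) by auto
    finally have fin: "finite S" .
    have "labels f S = M"
    proof (rule multiset_eqI)
      fix i
      show "count (labels f S) i = count M i"
      proof (cases "i < n")
        case True
        then have "of_nat (card (S \<inter> f -` {i})) = (of_nat (count M i) :: ennreal)"
          using S fin b by (simp add: emeasure_dirac_sum_finite)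
        then show ?thesis using fin by (simp add: count_labels)
      next
        case False
        then have "i \<notin># M" "S \<inter> f -` {i} = {}" using assms(1,3) by auto
        then show ?thesis using fin by (simp add: count_labels not_in_iff)
      qed
    qed
    then show "S \<in> {S \<in> finite_configs. labels f S = M}" using fin by (simp add: finite_configs_def)
  qed
qed

lemma labels_level_empty:
  assumes "\<And>x. f x < n" "\<not> set_mset M \<subseteq> {..<n}"
  shows "{S \<in> finite_configs. labels f S = M} = {}"
  using assms by (auto simp: finite_configs_def set_labels)

lemma sets_labels_level:
  assumes "\<And>x. f x < n" "f \<in> borel \<rightarrow>\<^sub>M count_space UNIV"
  shows "{S \<in> finite_configs. labels f S = M} \<in> sets config_space"
proof (cases "set_mset M \<subseteq> {..<n}")
  case True
  have [measurable]: "f -` {i} \<in> sets borel" for i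
    using measurable_sets[OF assms(2), of "{i}"] by simp
  have "{S \<in> space config_space. \<forall>i\<in>{..<n}. emeasure (dirac_sum S) (f -` {i}) = of_nat (count M i)} \<in> sets config_space"
  proof (rule sets.sets_Collect_finite_All)
    fix i
    have "(\<lambda>S. emeasure (dirac_sum S) (f -` {i})) -` {of_nat (count M i)} \<inter> space config_space \<in> sets config_space"
      by (rule measurable_sets[OF measurable_count]) auto
    then show "{S \<in> space config_space. emeasure (dirac_sum S) (f -` {i}) = of_nat (count M i)} \<in> sets config_space"
      by (simp add: vimage_def Int_def conj_commute)
  qed simp
  then show ?thesis
    unfolding labels_level[OF assms True] space_config_space by (simp only: Ball_def lessThan_iff)
next
  case False
  then show ?thesis unfolding labels_level_empty[of f n, OF assms(1) False] by simp
qed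

lemma label_events_sets: "label_events \<subseteq> sets config_space"
proof
  fix A :: "'a set set" assume "A \<in> label_events"
  then obtain f n K where f: "f \<in> borel \<rightarrow>\<^sub>M count_space UNIV" "\<And>x. f x < n"
    and A: "A = {S \<in> finite_configs. labels f S \<in> K}"
    by (rule label_eventsE) (rule that)
  have "A = (\<Union>M\<in>K. {S \<in> finite_configs. labels f S = M})" unfolding A by auto
  moreover have "countable K" by (rule countable_subset[OF subset_UNIV countable_UNIV_multiset])
  ultimately show "A \<in> sets config_space"
    using sets_labels_level[of f n] f by auto
qed

lemma sets_restrict_finite_configs:
  "sets (restrict_space (config_space :: 'a::metric_space set measure) finite_configs) =
    sigma_sets finite_configs label_events"
proof (rule antisym)
  let ?Q = "restrict_space config_space finite_configs :: 'a set measure"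
  have inter: "finite_configs \<inter> space config_space = (finite_configs :: 'a set set)"
    using finite_configs_subset by (auto simp: space_config_space)
  have iff: "A \<in> sets ?Q \<longleftrightarrow> A \<subseteq> finite_configs \<and> A \<in> sets config_space" for A
    by (rule sets_restrict_space_iff) (simp add: inter sets_finite_configs)
  have space: "space ?Q = finite_configs"
    using finite_configs_subset by (auto simp: space_restrict_space space_config_space)
  have "label_events \<subseteq> sets ?Q"
    unfolding subset_eq iff using label_events_sets label_events_subset by blast
  then show "sigma_sets finite_configs label_events \<subseteq> sets ?Q"
    using sets.sigma_sets_subset[of label_events ?Q] space by simp
  \<comment> \<open>An event inside \<open>finite_configs\<close> is its own preimage under this
    identity map, so measurability of the map gives the remaining inclusion.\<close>
  have id: "(\<lambda>S. S) \<in> sigma finite_configs label_events \<rightarrow>\<^sub>M (config_space :: 'a set measure)"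
  proof (rule measurable_into_config_space)
    fix B :: "'a set" assume B: "B \<in> sets borel"
    have sp: "space (sigma finite_configs label_events) = (finite_configs :: 'a set set)"
      by (rule space_measure_of[OF label_events_subset])
    show "(\<lambda>S. emeasure (dirac_sum S) B) \<in> borel_measurable (sigma finite_configs label_events)"
    proof (rule measurableI)
      fix C :: "ennreal set"
      \<comment> \<open>The partition into \<open>B\<close> and its complement: the multiplicity of
        label 1 is the count of \<open>B\<close>.\<close>
      let ?f = "\<lambda>x. of_bool (x \<in> B) :: nat"
      have "(\<lambda>S. emeasure (dirac_sum S) B) -` C \<inter> finite_configs =
        {S \<in> finite_configs. labels ?f S \<in> {M. of_nat (count M 1) \<in> C}}"
      proof -
        have "emeasure (dirac_sum S) B = of_nat (count (labels ?f S) 1)" if "S \<in> finite_configs" for S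
        proof -
          have "?f -` {1} = B" by (auto simp: of_bool_def)
          then show ?thesis
            using that B by (simp add: finite_configs_def emeasure_dirac_sum_finite count_labels)
        qed
        then show ?thesis by auto
      qed
      moreover have "?f \<in> borel \<rightarrow>\<^sub>M count_space UNIV" using B by measurable
      then have "{S \<in> finite_configs. labels ?f S \<in> {M. of_nat (count M 1) \<in> C}} \<in> label_events"
        by (rule label_eventsI[of _ 2]) auto
      ultimately show "(\<lambda>S. emeasure (dirac_sum S) B) -` C \<inter> space (sigma finite_configs label_events)
          \<in> sets (sigma finite_configs label_events)"
        unfolding sp sets_measure_of[OF label_events_subset] by (simp only: sigma_sets.Basic)
    qed simp
  next
    fix S :: "'a set" assume "S \<in> space (sigma finite_configs label_events)"
    then show "S \<in> configurations"
      using finite_configs_subset unfolding space_measure_of[OF label_events_subset] by blast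
  qed
  show "sets ?Q \<subseteq> sigma_sets finite_configs label_events"
  proof (rule subsetI)
    fix A :: "'a set set" assume "A \<in> sets ?Q"
    then have A: "A \<in> sets config_space" "A \<subseteq> finite_configs"
      using iff by blast+
    have "(\<lambda>S. S) -` A \<inter> space (sigma finite_configs label_events) = A"
      unfolding space_measure_of[OF label_events_subset] using A(2) by blast
    then have "A \<in> sets (sigma finite_configs label_events)"
      using measurable_sets[OF id A(1)] by (simp only:)
    then show "A \<in> sigma_sets finite_configs label_events"
      unfolding sets_measure_of[OF label_events_subset] .
  qed
qed

subsection \<open>Finite Poisson processes\<close>

lemma emeasure_label_sum:
  fixes \<mu> :: "'a::metric_space measure" and f :: "'a \<Rightarrow> nat"
  assumes "sets \<mu> = sets borel" "f \<in> borel \<rightarrow>\<^sub>M count_space UNIV" "\<And>x. f x < n"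
  shows "emeasure \<mu> {x. P (f x)} = (\<Sum>i<n. emeasure \<mu> (f -` {i}) * of_bool (P i))"
proof -
  have b: "f -` {i} \<in> sets \<mu>" for i
    using measurable_sets[OF assms(2), of "{i}"] assms(1) by simp
  have fin: "finite {i. i < n \<and> P i}" by (rule finite_subset[of _ "{..<n}"]) auto
  have "{x. P (f x)} = (\<Union>i\<in>{i. i < n \<and> P i}. f -` {i})" using assms(3) by auto
  then have "emeasure \<mu> {x. P (f x)} = (\<Sum>i\<in>{i. i < n \<and> P i}. emeasure \<mu> (f -` {i}))"
    using b fin by (simp only:) (rule sum_emeasure[symmetric], auto simp: disjoint_family_on_def)
  also have "\<dots> = (\<Sum>i<n. emeasure \<mu> (f -` {i}) * of_bool (P i))"
    by (rule sum.mono_neutral_cong_left) auto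
  finally show ?thesis .
qed

lemma card_label_sum:
  assumes "finite S" "\<And>x. f x < n"
  shows "card {x\<in>S. P (f x)} = (\<Sum>i<n. count (labels f S) i * of_bool (P i))"
proof -
  have fin: "finite {i. i < n \<and> P i}" by (rule finite_subset[of _ "{..<n}"]) auto
  have "{x\<in>S. P (f x)} = (\<Union>i\<in>{i. i < n \<and> P i}. S \<inter> f -` {i})" using assms(2) by auto
  then have "card {x\<in>S. P (f x)} = (\<Sum>i\<in>{i. i < n \<and> P i}. card (S \<inter> f -` {i}))"
    using assms(1) fin by (simp only:) (rule card_UN_disjoint, auto)
  also have "\<dots> = (\<Sum>i<n. count (labels f S) i * of_bool (P i))"
    using assms(1) by (intro sum.mono_neutral_cong_left) (auto simp: count_labels)
  finally show ?thesis .
qed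

text \<open>The point probability of a label multiset when the cell counts are independent Poisson
  variables. A multiset with a label outside \<open>{..<n}\<close> cannot occur and gets weight
  0.\<close>

definition poisson_weight :: "'a measure \<Rightarrow> ('a \<Rightarrow> nat) \<Rightarrow> nat \<Rightarrow> nat multiset \<Rightarrow> real" where
  "poisson_weight \<mu> f n M = (if set_mset M \<subseteq> {..<n} then
     \<Prod>i<n. exp (- measure \<mu> (f -` {i})) * measure \<mu> (f -` {i}) ^ count M i / fact (count M i) else 0)"

lemma poisson_weight_nonneg: "0 \<le> poisson_weight \<mu> f n M"
  by (auto simp: poisson_weight_def intro!: prod_nonneg)

text \<open>Only the factor of cell \<open>i\<close> changes, by one power of the cell mass and one
  factor of the factorial. This is the Mecke formula for a single cell.\<close>

lemma poisson_weight_add_mset: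
  assumes i: "i < n"
  shows "real (Suc (count M i)) * poisson_weight \<mu> f n (add_mset i M) =
    measure \<mu> (f -` {i}) * poisson_weight \<mu> f n M"
proof (cases "set_mset M \<subseteq> {..<n}")
  case True
  let ?q = "\<lambda>M j. exp (- measure \<mu> (f -` {j})) * measure \<mu> (f -` {j}) ^ count M j / fact (count M j)"
  have split: "(\<Prod>j<n. ?q N j) = ?q N i * (\<Prod>j\<in>{..<n} - {i}. ?q N j)" for N
    using i by (intro prod.remove) auto
  have other: "(\<Prod>j\<in>{..<n} - {i}. ?q (add_mset i M) j) = (\<Prod>j\<in>{..<n} - {i}. ?q M j)"
    by (intro prod.cong) auto
  have at_i: "real (Suc (count M i)) * ?q (add_mset i M) i = measure \<mu> (f -` {i}) * ?q M i"
    by (simp add: field_simps del: of_nat_Suc)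
  have "set_mset (add_mset i M) \<subseteq> {..<n}" using True i by simp
  then have "real (Suc (count M i)) * poisson_weight \<mu> f n (add_mset i M) =
    real (Suc (count M i)) * ?q (add_mset i M) i * (\<Prod>j\<in>{..<n} - {i}. ?q M j)"
    unfolding poisson_weight_def split other by (simp only: if_True mult.assoc)
  also have "\<dots> = measure \<mu> (f -` {i}) * (\<Prod>j<n. ?q M j)"
    unfolding at_i split by (simp only: mult.assoc)
  finally show ?thesis
    using True unfolding poisson_weight_def by (simp only: if_True)
qed (simp add: poisson_weight_def)

text \<open>The locale fixes one intensity measure; it is later instantiated with \<sigma> scaled by
  \<open>t\<close> or by \<open>l\<close>.\<close>

locale finite_poisson = finite_measure \<mu> for \<mu> :: "'a::metric_space measure" +
  fixes P :: "'a set measure"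
  assumes sets_mu: "sets \<mu> = sets borel"
    and diffuse: "\<And>x. emeasure \<mu> {x} = 0"
    and poisson: "poisson_measure \<mu> P"
begin

sublocale P: prob_space P
  using poisson by (simp add: poisson_measure_def)

lemma sets_P: "sets P = sets config_space"
  using poisson by (simp add: poisson_measure_def)

lemma space_P: "space P = configurations"
  using sets_eq_imp_space_eq[OF sets_P] by (simp add: space_config_space)

lemma space_mu: "space \<mu> = UNIV"
  using sets_eq_imp_space_eq[OF sets_mu] by simp

lemma prob_count:
  assumes "B \<in> sets borel"
  shows "P.prob {S \<in> space P. emeasure (dirac_sum S) B = of_nat k} =
    exp (- measure \<mu> B) * measure \<mu> B ^ k / fact k"
proof -
  have "emeasure \<mu> B < \<infinity>" using emeasure_finite[of B] by (metis infinity_ennreal_def less_top)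
  then show ?thesis using poisson assms unfolding poisson_measure_def by blast
qed

lemma prob_labels:
  assumes f: "\<And>x. f x < n" "f \<in> borel \<rightarrow>\<^sub>M count_space UNIV"
  shows "P.prob {S \<in> finite_configs. labels f S = M} = poisson_weight \<mu> f n M"
proof (cases "set_mset M \<subseteq> {..<n}")
  case True
  \<comment> \<open>Types are inhabited, so there is at least one label; the product rule for
    independent variables asks for a nonempty index set.\<close>
  have n: "0 < n" using f(1) by (metis gr_zeroI not_less_zero)
  have b: "f -` {i} \<in> sets borel" for i
    using measurable_sets[OF f(2), of "{i}"] by simp
  let ?X = "\<lambda>i S. emeasure (dirac_sum S) (f -` {i})"
  have "P.indep_vars (\<lambda>_. borel) ?X {..<n}"
  proof -
    have "disjoint_family_on (\<lambda>i. f -` {i}) {..<n}" by (auto simp: disjoint_family_on_def)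
    moreover have "\<forall>(n::nat) B. (\<forall>i<n. B i \<in> sets borel) \<and> disjoint_family_on B {..<n} \<longrightarrow>
        P.indep_vars (\<lambda>_. borel) (\<lambda>i S. emeasure (dirac_sum S) (B i)) {..<n}"
      using poisson by (simp add: poisson_measure_def)
    ultimately show ?thesis using b by (elim allE[where x = n] allE[where x = "\<lambda>i. f -` {i}"]) simp
  qed
  then have "P.prob (\<Inter>i\<in>{..<n}. ?X i -` {of_nat (count M i)} \<inter> space P) =
    (\<Prod>i\<in>{..<n}. P.prob (?X i -` {of_nat (count M i)} \<inter> space P))"
    using n by (intro P.indep_varsD_finite) auto
  also have "(\<Inter>i\<in>{..<n}. ?X i -` {of_nat (count M i)} \<inter> space P) = {S \<in> finite_configs. labels f S = M}"
    unfolding labels_level[OF f True] space_P using n by auto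
  also have "(\<Prod>i\<in>{..<n}. P.prob (?X i -` {of_nat (count M i)} \<inter> space P)) =
    (\<Prod>i<n. exp (- measure \<mu> (f -` {i})) * measure \<mu> (f -` {i}) ^ count M i / fact (count M i))"
  proof (rule prod.cong[OF refl])
    fix i
    have "?X i -` {of_nat (count M i)} \<inter> space P = {S \<in> space P. ?X i S = of_nat (count M i)}" by auto
    then show "P.prob (?X i -` {of_nat (count M i)} \<inter> space P) =
      exp (- measure \<mu> (f -` {i})) * measure \<mu> (f -` {i}) ^ count M i / fact (count M i)"
      using prob_count[OF b] by simp
  qed
  finally show ?thesis using True by (simp add: poisson_weight_def)
next
  case False
  then show ?thesis unfolding labels_level_empty[of f n, OF f(1) False] by (simp add: poisson_weight_def)
qed

text \<open>With \<open>m\<close> the total mass, the Poisson probabilities of the finite values of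
  the total count add up to \<open>exp (- m) * exp m\<close>.\<close>

lemma prob_finite_configs: "P.prob finite_configs = 1"
proof -
  let ?A = "\<lambda>k. {S \<in> space P. emeasure (dirac_sum S) UNIV = of_nat k}"
  have meas: "?A k \<in> sets P" for k
  proof -
    have "(\<lambda>S. emeasure (dirac_sum S) UNIV) -` {of_nat k} \<inter> space config_space \<in> sets config_space"
      by (rule measurable_sets[OF measurable_count]) auto
    then show ?thesis
      by (simp add: sets_P space_P space_config_space vimage_def Int_def conj_commute)
  qed
  have eq: "finite_configs = (\<Union>k. ?A k)"
  proof (rule set_eqI)
    fix S :: "'a set"
    show "S \<in> finite_configs \<longleftrightarrow> S \<in> (\<Union>k. ?A k)"
    proof
      assume "S \<in> finite_configs"
      then show "S \<in> (\<Union>k. ?A k)"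
        using finite_configs_subset
        by (auto simp: finite_configs_def space_P emeasure_dirac_sum_finite intro!: exI[of _ "card S"])
    next
      assume "S \<in> (\<Union>k. ?A k)"
      then show "S \<in> finite_configs"
        unfolding finite_configs_eq space_P by (auto simp: of_nat_less_top)
    qed
  qed
  have "(\<lambda>k. P.prob (?A k)) sums P.prob (\<Union>k. ?A k)"
    using meas by (intro P.finite_measure_UNION) (auto simp: disjoint_family_on_def)
  moreover have "(\<lambda>k. exp (- measure \<mu> UNIV) * (measure \<mu> UNIV ^ k /\<^sub>R fact k)) sums
      (exp (- measure \<mu> UNIV) * exp (measure \<mu> UNIV))"
    by (intro sums_mult exp_converges)
  moreover have "exp (- measure \<mu> UNIV) * (measure \<mu> UNIV ^ k /\<^sub>R fact k) = P.prob (?A k)" for k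
    by (simp add: prob_count field_simps)
  ultimately have "P.prob (\<Union>k. ?A k) = exp (- measure \<mu> UNIV) * exp (measure \<mu> UNIV)"
    by (simp add: sums_iff)
  then show ?thesis unfolding eq by (simp flip: exp_add)
qed

lemma sets_finite_P: "finite_configs \<in> sets P"
  by (simp add: sets_P sets_finite_configs)

lemma finite_Int_space: "finite_configs \<inter> space P = finite_configs"
  using finite_configs_subset by (auto simp: space_P)

lemma AE_finite: "AE S in P. finite S"
  using P.AE_prob_1[OF prob_finite_configs] by (simp add: finite_configs_def)

text \<open>On finite configurations all counts are natural numbers and the label events generate
  the \<sigma>-algebra, while no probability is lost.\<close>

definition Q :: "'a set measure" where
  "Q = restrict_space P finite_configs"

lemma space_Q: "space Q = finite_configs"
  using finite_configs_subset by (auto simp: Q_def space_restrict_space space_P)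

lemma sets_Q_config: "sets Q = sets (restrict_space config_space finite_configs)"
  by (simp add: Q_def sets_P sets_restrict_space)

lemma sets_Q: "sets Q = sigma_sets finite_configs label_events"
  by (simp add: sets_Q_config sets_restrict_finite_configs)

lemma sets_Q_iff: "A \<in> sets Q \<longleftrightarrow> A \<subseteq> finite_configs \<and> A \<in> sets config_space"
  unfolding Q_def using sets_restrict_space_iff[of finite_configs P A] sets_finite_P
  by (simp add: sets_P finite_Int_space)

lemma emeasure_Q: "A \<in> sets Q \<Longrightarrow> emeasure Q A = emeasure P A"
  using sets_Q_iff[of A] sets_finite_P unfolding Q_def
  by (intro emeasure_restrict_space) (simp_all add: finite_Int_space)

lemma measurable_Q: "f \<in> config_space \<rightarrow>\<^sub>M N \<Longrightarrow> f \<in> Q \<rightarrow>\<^sub>M N"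
  unfolding Q_def by (intro measurable_restrict_space1) (simp add: measurable_cong_sets[OF sets_P refl])

lemma nn_integral_Q: "(\<integral>\<^sup>+S. f S \<partial>P) = (\<integral>\<^sup>+S. f S \<partial>Q)"
proof -
  have "(\<integral>\<^sup>+S. f S \<partial>P) = (\<integral>\<^sup>+S. f S * indicator finite_configs S \<partial>P)"
    using AE_finite by (intro nn_integral_cong_AE) (auto simp: finite_configs_def)
  also have "\<dots> = (\<integral>\<^sup>+S. f S \<partial>Q)"
    unfolding Q_def using sets_finite_P
    by (subst nn_integral_restrict_space) (simp_all add: finite_Int_space)
  finally show ?thesis .
qed

sublocale Q: prob_space Q
proof
  show "emeasure Q (space Q) = 1"
    using emeasure_Q[of finite_configs] sets.top[of Q] prob_finite_configs
    by (simp add: space_Q P.emeasure_eq_measure)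
qed

lemma emeasure_labels:
  assumes f: "\<And>x. f x < n" "f \<in> borel \<rightarrow>\<^sub>M count_space UNIV"
  shows "emeasure Q {S \<in> finite_configs. labels f S = M} = ennreal (poisson_weight \<mu> f n M)"
proof -
  have "{S \<in> finite_configs. labels f S = M} \<in> sets Q"
    using sets_labels_level[of f n M] f by (auto simp: sets_Q_iff)
  then show ?thesis
    using prob_labels[of f n M] f by (simp add: emeasure_Q P.emeasure_eq_measure)
qed

text \<open>The level sets of \<open>labels f\<close> split the finite configurations into countably
  many events, so the integral is a series against the weights.\<close>

lemma nn_integral_labels:
  assumes f: "\<And>x. f x < n" "f \<in> borel \<rightarrow>\<^sub>M count_space UNIV"
  shows "(\<integral>\<^sup>+S. F (labels f S) \<partial>Q) = (\<integral>\<^sup>+M. F M * ennreal (poisson_weight \<mu> f n M) \<partial>count_space UNIV)"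
proof -
  have lev: "{S \<in> finite_configs. labels f S = M} \<in> sets Q" for M
    using sets_labels_level[of f n M] f by (auto simp: sets_Q_iff)
  have "(\<integral>\<^sup>+S. F (labels f S) \<partial>Q) =
    (\<integral>\<^sup>+S. (\<integral>\<^sup>+M. F M * indicator {S \<in> finite_configs. labels f S = M} S \<partial>count_space UNIV) \<partial>Q)"
  proof (rule nn_integral_cong)
    fix S assume S: "S \<in> space Q"
    have "(\<integral>\<^sup>+M. F M * indicator {S \<in> finite_configs. labels f S = M} S \<partial>count_space UNIV) =
      (\<integral>\<^sup>+M. F M * indicator {labels f S} M \<partial>count_space UNIV)"
      using S by (intro nn_integral_cong) (auto simp: space_Q split: split_indicator)
    also have "\<dots> = F (labels f S)"
      by (simp add: nn_integral_indicator_singleton)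
    finally show "F (labels f S) =
      (\<integral>\<^sup>+M. F M * indicator {S \<in> finite_configs. labels f S = M} S \<partial>count_space UNIV)" by simp
  qed
  also have "\<dots> = (\<integral>\<^sup>+M. (\<integral>\<^sup>+S. F M * indicator {S \<in> finite_configs. labels f S = M} S \<partial>Q) \<partial>count_space UNIV)"
    using lev by (intro nn_integral_count_space_nn_integral countable_UNIV_multiset) auto
  also have "\<dots> = (\<integral>\<^sup>+M. F M * ennreal (poisson_weight \<mu> f n M) \<partial>count_space UNIV)"
    using lev f by (intro nn_integral_cong) (simp add: nn_integral_cmult_indicator emeasure_labels[of f n])
  finally show ?thesis .
qed

end

subsection \<open>The Mecke formula\<close>

text \<open>Uniqueness of measures, phrased for set functions because the sides of the Mecke formula
  arise as integrals that depend on an event. Finiteness of \<open>\<phi> \<Omega>\<close> permits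
  cancellation in the complement step.\<close>

lemma countably_additive_eqI:
  fixes \<phi> \<psi> :: "'b set \<Rightarrow> ennreal"
  assumes G: "Int_stable G" "G \<subseteq> Pow \<Omega>" "\<Omega> \<in> G"
    and \<phi>: "positive (sigma_sets \<Omega> G) \<phi>" "countably_additive (sigma_sets \<Omega> G) \<phi>"
    and \<psi>: "positive (sigma_sets \<Omega> G) \<psi>" "countably_additive (sigma_sets \<Omega> G) \<psi>"
    and fin: "\<phi> \<Omega> < \<infinity>"
    and eq: "\<And>A. A \<in> G \<Longrightarrow> \<phi> A = \<psi> A"
    and A: "A \<in> sigma_sets \<Omega> G"
  shows "\<phi> A = \<psi> A"
  using G(1,2) A
proof (induction A rule: sigma_sets_induct_disjoint)
  interpret sigma_algebra \<Omega> "sigma_sets \<Omega> G" using G(2) by (rule sigma_algebra_sigma_sets)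
  {
    case (compl A)
    have *: "A \<union> (\<Omega> - A) = \<Omega>" using sigma_sets_into_sp[OF G(2) compl(1)] by auto
    have 1: "\<phi> \<Omega> = \<phi> A + \<phi> (\<Omega> - A)"
      using additiveD[OF countably_additive_additive[OF \<phi>], of A "\<Omega> - A"] compl(1) *
      by (auto intro: sigma_sets.Compl)
    have 2: "\<psi> \<Omega> = \<psi> A + \<psi> (\<Omega> - A)"
      using additiveD[OF countably_additive_additive[OF \<psi>], of A "\<Omega> - A"] compl(1) *
      by (auto intro: sigma_sets.Compl)
    have "\<phi> A < \<infinity>" using fin 1 by (auto simp: less_top[symmetric])
    then show ?case
      using 1 2 compl(2) eq[OF G(3)] by (metis ennreal_add_left_cancel infinity_ennreal_def less_irrefl)
  next
    case (union A)
    have U: "(\<Union>i. A i) \<in> sigma_sets \<Omega> G" using union(2) by (auto intro: sigma_sets.Union)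
    have "\<phi> (\<Union>i. A i) = (\<Sum>i. \<phi> (A i))"
      using \<phi>(2) union(1,2) U unfolding countably_additive_def by simp
    also have "\<dots> = (\<Sum>i. \<psi> (A i))" using union(3) by simp
    also have "\<dots> = \<psi> (\<Union>i. A i)"
      using \<psi>(2) union(1,2) U unfolding countably_additive_def by simp
    finally show ?case .
  }
qed (use eq \<phi>(1) \<psi>(1) in \<open>auto simp: positive_def\<close>)

context finite_poisson
begin

text \<open>
  In this notation the Mecke formula reads
  \<open>E [1\<^sub>B (\<omega>) \<Sum>x\<in>\<omega>. 1\<^sub>A (\<omega> - \<delta>\<^sub>x)] = E [1\<^sub>A (\<omega>) \<integral> 1\<^sub>B (\<omega> + \<delta>\<^sub>x) \<mu>(dx)]\<close>.
\<close>

definition adds :: "'a set set \<Rightarrow> 'a set \<Rightarrow> ennreal" where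
  "adds A S = emeasure \<mu> {x. insert x S \<in> A}"

definition removals :: "'a set set \<Rightarrow> 'a set \<Rightarrow> ennreal" where
  "removals A S = emeasure (dirac_sum S) {x\<in>S. S - {x} \<in> A}"

lemma measurable_adds: "A \<in> sets config_space \<Longrightarrow> adds A \<in> borel_measurable config_space"
  using measurable_emeasure_insert[OF sets_mu finite_measure_axioms diffuse] by (simp add: adds_def[abs_def])

lemma removals_finite:
  assumes "finite S" shows "removals A S = of_nat (card {x\<in>S. S - {x} \<in> A})"
proof -
  have "{x\<in>S. S - {x} \<in> A} \<in> sets borel"
    using assms by (intro borel_countable countable_finite) simp
  moreover have "S \<inter> {x\<in>S. S - {x} \<in> A} = {x\<in>S. S - {x} \<in> A}" by auto
  ultimately show ?thesis
    unfolding removals_def using assms by (simp add: emeasure_dirac_sum_finite)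
qed

lemma measurable_removals_Q:
  assumes "A \<in> sets config_space" shows "removals A \<in> borel_measurable Q"
proof -
  have "(\<lambda>S. if emeasure (dirac_sum S) UNIV < \<infinity>
      then emeasure (dirac_sum S) {x\<in>UNIV. x \<in> S \<and> S - {x} \<in> A} else 0) \<in> borel_measurable Q"
    using assms by (intro measurable_Q measurable_emeasure_remove) auto
  moreover have "emeasure (dirac_sum S) UNIV < \<infinity>" if "S \<in> space Q" for S
    using that unfolding space_Q finite_configs_eq by blast
  ultimately show ?thesis
    unfolding removals_def[abs_def] by (subst measurable_cong) (auto cong: conj_cong)
qed

lemma adds_label_event:
  assumes f: "\<And>x. f x < n" "f \<in> borel \<rightarrow>\<^sub>M count_space UNIV" and S: "finite S"
  shows "adds {S \<in> finite_configs. labels f S \<in> L} S =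
    (\<Sum>i<n. emeasure \<mu> (f -` {i}) * of_bool (add_mset i (labels f S) \<in> L))"
proof -
  let ?B = "{S \<in> finite_configs. labels f S \<in> L}"
  have B: "?B \<in> sets config_space"
    using label_eventsI[of f n L] f label_events_sets by auto
  have "AE x in \<mu>. x \<notin> S"
    using S sets_mu by (intro AE_discrete_difference) (auto simp: countable_finite diffuse)
  then have "AE x in \<mu>. x \<in> {x. insert x S \<in> ?B} \<longleftrightarrow> x \<in> {x. add_mset (f x) (labels f S) \<in> L}"
    by eventually_elim (use S in \<open>simp add: labels_insert finite_configs_def\<close>)
  moreover have "{x. insert x S \<in> ?B} \<in> sets \<mu>"
    using insert_preimage_borel[OF finite_configurations[OF S] B] sets_mu by simp
  moreover have "{x. add_mset (f x) (labels f S) \<in> L} \<in> sets \<mu>"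
  proof -
    have "f -` {i. add_mset i (labels f S) \<in> L} \<inter> space borel \<in> sets borel"
      by (rule measurable_sets[OF f(2)]) simp
    then show ?thesis using sets_mu by (simp add: vimage_def)
  qed
  ultimately have "adds ?B S = emeasure \<mu> {x. add_mset (f x) (labels f S) \<in> L}"
    unfolding adds_def by (rule emeasure_eq_AE)
  also have "\<dots> = (\<Sum>i<n. emeasure \<mu> (f -` {i}) * of_bool (add_mset i (labels f S) \<in> L))"
    by (rule emeasure_label_sum[OF sets_mu f(2,1)])
  finally show ?thesis .
qed

lemma removals_label_event:
  assumes f: "\<And>x. f x < n" and S: "finite S"
  shows "removals {S \<in> finite_configs. labels f S \<in> K} S =
    (\<Sum>i<n. of_nat (count (labels f S) i) * of_bool (labels f S - {#i#} \<in> K))"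
proof -
  have "{x\<in>S. S - {x} \<in> {S \<in> finite_configs. labels f S \<in> K}} = {x\<in>S. labels f S - {#f x#} \<in> K}"
    using S by (auto simp: finite_configs_def labels_remove)
  then have "removals {S \<in> finite_configs. labels f S \<in> K} S = of_nat (card {x\<in>S. labels f S - {#f x#} \<in> K})"
    using S by (simp add: removals_finite)
  also have "\<dots> = of_nat (\<Sum>i<n. count (labels f S) i * of_bool (labels f S - {#i#} \<in> K))"
    using card_label_sum[of S f n "\<lambda>i. labels f S - {#i#} \<in> K"] S f by simp
  finally show ?thesis by (simp add: of_bool_def if_distrib cong: if_cong)
qed

text \<open>Both sides become sums over cells \<open>i\<close> and label multisets. Removing a point
  of label \<open>i\<close> undoes \<open>add_mset i\<close>, so reindexing by this map and
  \<open>poisson_weight_add_mset\<close> match the terms.\<close>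

lemma Mecke_label_events:
  assumes A: "A \<in> label_events" and B: "B \<in> label_events"
  shows "(\<integral>\<^sup>+S. indicator B S * removals A S \<partial>Q) = (\<integral>\<^sup>+S. indicator A S * adds B S \<partial>Q)"
proof -
  obtain f n K L where f: "f \<in> borel \<rightarrow>\<^sub>M count_space UNIV" "\<And>x. f x < n"
    and AK: "A = {S \<in> finite_configs. labels f S \<in> K}" and BL: "B = {S \<in> finite_configs. labels f S \<in> L}"
    using A B by (rule label_events_common) (rule that)
  let ?w = "\<lambda>M. ennreal (poisson_weight \<mu> f n M)"
  note f' = f(2) f(1)
  have weight: "of_nat (Suc (count M i)) * ?w (add_mset i M) = emeasure \<mu> (f -` {i}) * ?w M" if "i < n" for i M
    using poisson_weight_add_mset[OF that, of M \<mu> f]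
    by (simp add: emeasure_eq_measure poisson_weight_nonneg ennreal_mult[symmetric]
        ennreal_of_nat_eq_real_of_nat del: of_nat_Suc)
  have "(\<integral>\<^sup>+S. indicator B S * removals A S \<partial>Q) =
      (\<integral>\<^sup>+S. of_bool (labels f S \<in> L) *
        (\<Sum>i<n. of_nat (count (labels f S) i) * of_bool (labels f S - {#i#} \<in> K)) \<partial>Q)"
  proof (rule nn_integral_cong)
    fix S assume "S \<in> space Q"
    then have "finite S" by (simp add: space_Q finite_configs_def)
    then show "indicator B S * removals A S = of_bool (labels f S \<in> L) *
        (\<Sum>i<n. of_nat (count (labels f S) i) * of_bool (labels f S - {#i#} \<in> K))"
      unfolding AK using removals_label_event[OF f(2), where S = S and K = K]
      by (simp add: BL finite_configs_def indicator_def)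
  qed
  also have "\<dots> = (\<integral>\<^sup>+M. of_bool (M \<in> L) * (\<Sum>i<n. of_nat (count M i) * of_bool (M - {#i#} \<in> K)) * ?w M \<partial>count_space UNIV)"
    by (rule nn_integral_labels[OF f'])
  also have "\<dots> = (\<Sum>i<n. \<integral>\<^sup>+M. of_bool (M \<in> L) * (of_nat (count M i) * of_bool (M - {#i#} \<in> K)) * ?w M \<partial>count_space UNIV)"
    unfolding sum_distrib_left sum_distrib_right by (rule nn_integral_sum) simp
  also have "\<dots> = (\<Sum>i<n. \<integral>\<^sup>+M. of_bool (M \<in> K) * (emeasure \<mu> (f -` {i}) * of_bool (add_mset i M \<in> L)) * ?w M \<partial>count_space UNIV)"
  proof (rule sum.cong[OF refl])
    fix i assume "i \<in> {..<n}"
    then have i: "i < n" by simp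
    let ?g = "\<lambda>M. of_bool (M \<in> L) * (of_nat (count M i) * of_bool (M - {#i#} \<in> K)) * ?w M"
    \<comment> \<open>Multisets without label \<open>i\<close> carry the factor
      \<open>count M i = 0\<close>; all others have a unique predecessor under
      \<open>add_mset i\<close>.\<close>
    have "(\<integral>\<^sup>+M. ?g M \<partial>count_space UNIV) = (\<integral>\<^sup>+M. ?g M \<partial>count_space (range (add_mset i)))"
    proof (rule nn_integral_count_space_eq)
      fix M assume "M \<in> UNIV - range (add_mset i)"
      then have "i \<notin># M" by (metis DiffE insert_DiffM rangeI)
      then show "?g M = 0" by (simp add: not_in_iff)
    qed auto
    also have "\<dots> = (\<integral>\<^sup>+M. ?g (add_mset i M) \<partial>count_space UNIV)"
      by (rule nn_integral_bij_count_space[symmetric]) (simp add: bij_betw_def inj_on_def)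
    also have "\<dots> = (\<integral>\<^sup>+M. of_bool (M \<in> K) * (emeasure \<mu> (f -` {i}) * of_bool (add_mset i M \<in> L)) * ?w M \<partial>count_space UNIV)"
    proof (rule nn_integral_cong)
      fix M
      have "?g (add_mset i M) = of_bool (add_mset i M \<in> L) * of_bool (M \<in> K) *
          (of_nat (Suc (count M i)) * ?w (add_mset i M))"
        by (simp add: ac_simps del: of_nat_Suc)
      also have "\<dots> = of_bool (M \<in> K) * (emeasure \<mu> (f -` {i}) * of_bool (add_mset i M \<in> L)) * ?w M"
        unfolding weight[OF i] by (simp add: ac_simps)
      finally show "?g (add_mset i M) =
        of_bool (M \<in> K) * (emeasure \<mu> (f -` {i}) * of_bool (add_mset i M \<in> L)) * ?w M" .
    qed
    finally show "(\<integral>\<^sup>+M. ?g M \<partial>count_space UNIV) =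
      (\<integral>\<^sup>+M. of_bool (M \<in> K) * (emeasure \<mu> (f -` {i}) * of_bool (add_mset i M \<in> L)) * ?w M \<partial>count_space UNIV)" .
  qed
  also have "\<dots> = (\<integral>\<^sup>+M. of_bool (M \<in> K) * (\<Sum>i<n. emeasure \<mu> (f -` {i}) * of_bool (add_mset i M \<in> L)) * ?w M \<partial>count_space UNIV)"
    unfolding sum_distrib_left sum_distrib_right by (rule nn_integral_sum[symmetric]) simp
  also have "\<dots> = (\<integral>\<^sup>+S. of_bool (labels f S \<in> K) *
      (\<Sum>i<n. emeasure \<mu> (f -` {i}) * of_bool (add_mset i (labels f S) \<in> L)) \<partial>Q)"
    by (rule nn_integral_labels[OF f', symmetric])
  also have "\<dots> = (\<integral>\<^sup>+S. indicator A S * adds B S \<partial>Q)"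
  proof (rule nn_integral_cong)
    fix S assume "S \<in> space Q"
    then have "finite S" by (simp add: space_Q finite_configs_def)
    then show "of_bool (labels f S \<in> K) *
        (\<Sum>i<n. emeasure \<mu> (f -` {i}) * of_bool (add_mset i (labels f S) \<in> L)) = indicator A S * adds B S"
      unfolding BL using adds_label_event[OF f', where S = S and L = L]
      by (simp add: AK finite_configs_def indicator_def)
  qed
  finally show ?thesis .
qed

lemma removals_space: "finite S \<Longrightarrow> removals finite_configs S = of_nat (card S)"
  by (simp add: removals_finite finite_configs_def)

lemma adds_le: "adds A S \<le> emeasure \<mu> UNIV"
  unfolding adds_def using sets_mu by (intro emeasure_mono) auto

lemma positive_weighted:
  "positive (sets Q) (\<lambda>A. \<integral>\<^sup>+S. indicator A S * h S \<partial>Q)"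
  by (simp add: positive_def)

lemma countably_additive_weighted:
  assumes h: "h \<in> borel_measurable Q"
  shows "countably_additive (sets Q) (\<lambda>A. \<integral>\<^sup>+S. indicator A S * h S \<partial>Q)"
proof -
  have "emeasure (density Q h) A = (\<integral>\<^sup>+S. indicator A S * h S \<partial>Q)" if "A \<in> sets Q" for A
    using that h by (simp add: emeasure_density mult.commute)
  moreover have "countably_additive (sets Q) (emeasure (density Q h))"
    using emeasure_countably_additive[of "density Q h"] by simp
  ultimately show ?thesis
    unfolding countably_additive_def by (simp add: subset_eq sets.countable_UN)
qed

text \<open>\<open>countably_additive_weighted\<close> treats the event that enters through its
  indicator, and this lemma the event that enters through \<open>adds\<close> or
  \<open>removals\<close>.\<close>

lemma countably_additive_kernel:
  assumes k: "\<And>A. A \<in> sets Q \<Longrightarrow> k A \<in> borel_measurable Q" and h: "h \<in> borel_measurable Q"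
    and add: "\<And>A S. S \<in> finite_configs \<Longrightarrow> range A \<subseteq> sets Q \<Longrightarrow> disjoint_family A \<Longrightarrow> k (\<Union>i::nat. A i) S = (\<Sum>i. k (A i) S)"
  shows "countably_additive (sets Q) (\<lambda>A. \<integral>\<^sup>+S. h S * k A S \<partial>Q)"
  unfolding countably_additive_def
proof (intro allI impI)
  fix A :: "nat \<Rightarrow> 'a set set" assume A: "range A \<subseteq> sets Q" "disjoint_family A"
  have "(\<integral>\<^sup>+S. h S * k (\<Union>i. A i) S \<partial>Q) = (\<integral>\<^sup>+S. (\<Sum>i. h S * k (A i) S) \<partial>Q)"
    using A by (intro nn_integral_cong) (simp add: add space_Q)
  also have "\<dots> = (\<Sum>i. \<integral>\<^sup>+S. h S * k (A i) S \<partial>Q)"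
    using k h A by (intro nn_integral_suminf) auto
  finally show "(\<Sum>i. \<integral>\<^sup>+S. h S * k (A i) S \<partial>Q) = (\<integral>\<^sup>+S. h S * k (\<Union>i. A i) S \<partial>Q)" by simp
qed

lemma adds_suminf:
  assumes "S \<in> finite_configs" "range A \<subseteq> sets Q" "disjoint_family A"
  shows "adds (\<Union>i::nat. A i) S = (\<Sum>i. adds (A i) S)"
proof -
  have "{x. insert x S \<in> A i} \<in> sets \<mu>" for i
    using insert_preimage_borel[of S "A i"] assms finite_configs_subset sets_mu sets_Q_iff by auto
  then have "(\<Sum>i. adds (A i) S) = emeasure \<mu> (\<Union>i. {x. insert x S \<in> A i})"
    unfolding adds_def using assms(3) by (intro suminf_emeasure) (auto simp: disjoint_family_on_def)
  also have "(\<Union>i. {x. insert x S \<in> A i}) = {x. insert x S \<in> (\<Union>i. A i)}" by auto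
  finally show ?thesis by (simp add: adds_def)
qed

lemma removals_suminf:
  assumes "S \<in> finite_configs" "disjoint_family A"
  shows "removals (\<Union>i::nat. A i) S = (\<Sum>i. removals (A i) S)"
proof -
  have "{x\<in>S. S - {x} \<in> A i} \<in> sets (dirac_sum S)" for i
    using assms(1) by (auto simp: finite_configs_def intro!: borel_countable countable_finite)
  then have "(\<Sum>i. removals (A i) S) = emeasure (dirac_sum S) (\<Union>i. {x\<in>S. S - {x} \<in> A i})"
    unfolding removals_def using assms(2) by (intro suminf_emeasure) (auto simp: disjoint_family_on_def)
  also have "(\<Union>i. {x\<in>S. S - {x} \<in> A i}) = {x\<in>S. S - {x} \<in> (\<Union>i. A i)}" by auto
  finally show ?thesis by (simp add: removals_def)
qed

lemma sets_Q_config_space: "A \<in> sets Q \<Longrightarrow> A \<in> sets config_space"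
  by (simp add: sets_Q_iff)

text \<open>The added mass is at most the total mass. This bound supplies the finiteness for the
  uniqueness argument and for splitting \<open>enn2real\<close> of a sum.\<close>

lemma adds_integral_finite: "(\<integral>\<^sup>+S. indicator A S * adds B S \<partial>Q) < \<infinity>"
proof -
  have "(\<integral>\<^sup>+S. indicator A S * adds B S \<partial>Q) \<le> (\<integral>\<^sup>+S. emeasure \<mu> UNIV \<partial>Q)"
    using adds_le by (intro nn_integral_mono) (auto split: split_indicator)
  also have "\<dots> < \<infinity>"
    using emeasure_finite[of UNIV] Q.emeasure_space_1 by (simp add: less_top[symmetric])
  finally show ?thesis .
qed

lemma Mecke:
  assumes A: "A \<in> sets Q" and B: "B \<in> sets Q"
  shows "(\<integral>\<^sup>+S. indicator B S * removals A S \<partial>Q) = (\<integral>\<^sup>+S. indicator A S * adds B S \<partial>Q)"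
proof -
  have label_Q: "A \<in> label_events \<Longrightarrow> A \<in> sets Q" for A
    by (simp add: sets_Q sigma_sets.Basic)
  have rem: "removals A \<in> borel_measurable Q" if "A \<in> sets Q" for A
    using that by (intro measurable_removals_Q sets_Q_config_space)
  have add: "adds A \<in> borel_measurable Q" if "A \<in> sets Q" for A
    using that by (intro measurable_Q measurable_adds sets_Q_config_space)
  note G = Int_stable_label_events[where 'a = 'a] label_events_subset[where 'a = 'a]
    finite_configs_label_events[where 'a = 'a]
  \<comment> \<open>The events are made general one at a time: here \<open>B\<close>, with
    \<open>A\<close> still a label event; afterwards \<open>A\<close>, with \<open>B\<close> already
    arbitrary.\<close>
  have step: "(\<integral>\<^sup>+S. indicator B S * removals A S \<partial>Q) = (\<integral>\<^sup>+S. indicator A S * adds B S \<partial>Q)"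
    if A: "A \<in> label_events" for A
  proof (rule countably_additive_eqI[OF G, folded sets_Q, where A = B and \<phi> = "\<lambda>B. \<integral>\<^sup>+S. indicator B S * removals A S \<partial>Q"
        and \<psi> = "\<lambda>B. \<integral>\<^sup>+S. indicator A S * adds B S \<partial>Q"])
    \<comment> \<open>The number of removable points has no uniform bound; finiteness is read off
      from the bounded \<open>adds\<close> side.\<close>
    show "(\<integral>\<^sup>+S. indicator finite_configs S * removals A S \<partial>Q) < \<infinity>"
      unfolding Mecke_label_events[OF A finite_configs_label_events] by (rule adds_integral_finite)
    show "countably_additive (sets Q) (\<lambda>B. \<integral>\<^sup>+S. indicator A S * adds B S \<partial>Q)"
      using add adds_suminf label_Q[OF A] by (intro countably_additive_kernel) auto
    show "countably_additive (sets Q) (\<lambda>B. \<integral>\<^sup>+S. indicator B S * removals A S \<partial>Q)"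
      by (intro countably_additive_weighted rem label_Q A)
    show "positive (sets Q) (\<lambda>B. \<integral>\<^sup>+S. indicator B S * removals A S \<partial>Q)"
      by (rule positive_weighted)
    show "positive (sets Q) (\<lambda>B. \<integral>\<^sup>+S. indicator A S * adds B S \<partial>Q)"
      by (simp add: positive_def adds_def)
  qed (use A B Mecke_label_events in auto)
  show ?thesis
  proof (rule countably_additive_eqI[OF G, folded sets_Q, where A = A and \<phi> = "\<lambda>A. \<integral>\<^sup>+S. indicator B S * removals A S \<partial>Q"
        and \<psi> = "\<lambda>A. \<integral>\<^sup>+S. indicator A S * adds B S \<partial>Q"])
    show "(\<integral>\<^sup>+S. indicator B S * removals finite_configs S \<partial>Q) < \<infinity>"
      unfolding step[OF finite_configs_label_events] by (rule adds_integral_finite)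
    show "countably_additive (sets Q) (\<lambda>A. \<integral>\<^sup>+S. indicator B S * removals A S \<partial>Q)"
      using rem removals_suminf B by (intro countably_additive_kernel) auto
    show "countably_additive (sets Q) (\<lambda>A. \<integral>\<^sup>+S. indicator A S * adds B S \<partial>Q)"
      by (intro countably_additive_weighted add B)
    show "positive (sets Q) (\<lambda>A. \<integral>\<^sup>+S. indicator A S * adds B S \<partial>Q)"
      by (rule positive_weighted)
    show "positive (sets Q) (\<lambda>A. \<integral>\<^sup>+S. indicator B S * removals A S \<partial>Q)"
      by (simp add: positive_def removals_def)
  qed (use A step in auto)
qed

end

subsection \<open>Dependence on the intensity\<close>

context finite_poisson
begin

lemma card_level_sets: "{S \<in> finite_configs. card S = k} \<in> sets Q"
proof -
  have "{S \<in> finite_configs. labels (\<lambda>_. 0) S \<in> {M. size M = k}} \<in> (label_events :: 'a set set set)"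
    by (rule label_eventsI[of _ 1]) auto
  then show ?thesis by (simp add: sets_Q sigma_sets.Basic)
qed

lemma measurable_card_Q: "card \<in> Q \<rightarrow>\<^sub>M count_space UNIV"
proof (rule measurable_count_space_eq2_countable[THEN iffD2])
  have "card -` {k} \<inter> space Q = {S \<in> finite_configs. card S = k}" for k
    by (auto simp: space_Q)
  then show "card \<in> space Q \<rightarrow> UNIV \<and> (\<forall>k\<in>UNIV. card -` {k} \<inter> space Q \<in> sets Q)"
    using card_level_sets by simp
qed

lemma Int_finite_configs_sets_Q: "A \<in> sets config_space \<Longrightarrow> A \<inter> finite_configs \<in> sets Q"
  unfolding sets_Q_iff using sets.Int[OF _ sets_finite_configs] by blast

lemma finite_configs_Diff_sets_Q: "A \<in> sets config_space \<Longrightarrow> finite_configs - A \<in> sets Q"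
  unfolding sets_Q_iff using sets.Diff[OF sets_finite_configs] by blast

lemma prob_eq_Q: "A \<in> sets config_space \<Longrightarrow> P.prob A = Q.prob (A \<inter> finite_configs)"
proof -
  assume A: "A \<in> sets config_space"
  have "P.prob A = P.prob (A \<inter> finite_configs)"
  proof (rule P.finite_measure_eq_AE)
    show "AE S in P. S \<in> A \<longleftrightarrow> S \<in> A \<inter> finite_configs"
      using AE_finite by eventually_elim (simp add: finite_configs_def)
    show "A \<in> P.events" using A by (simp add: sets_P)
    show "A \<inter> finite_configs \<in> P.events"
      unfolding sets_P using sets.Int[OF A sets_finite_configs] .
  qed
  also have "\<dots> = Q.prob (A \<inter> finite_configs)"
    using emeasure_Q[OF Int_finite_configs_sets_Q[OF A]] by (simp add: measure_def)
  finally show ?thesis .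
qed

lemma nn_integral_card:
  assumes A: "A \<in> sets Q"
  shows "(\<integral>\<^sup>+S. indicator A S * of_nat (card S) \<partial>Q) = (\<Sum>k. ennreal (real k * Q.prob {S\<in>A. card S = k}))"
proof -
  have lev: "{S\<in>A. card S = k} \<in> sets Q" for k
  proof -
    have "{S\<in>A. card S = k} = A \<inter> {S \<in> finite_configs. card S = k}"
      using A by (auto simp: sets_Q_iff)
    then show ?thesis using A card_level_sets by auto
  qed
  have "(\<integral>\<^sup>+S. indicator A S * of_nat (card S) \<partial>Q) =
    (\<integral>\<^sup>+S. (\<Sum>k. of_nat k * indicator {S\<in>A. card S = k} S) \<partial>Q)"
  proof (rule nn_integral_cong)
    fix S
    have "of_nat k * indicator {S\<in>A. card S = k} S = (if k = card S then indicator A S * of_nat k else 0 :: ennreal)" for k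
      by (simp add: indicator_def)
    then show "indicator A S * of_nat (card S) = (\<Sum>k. of_nat k * indicator {S\<in>A. card S = k} S :: ennreal)"
      using sums_unique[OF sums_single[of "card S" "\<lambda>k. indicator A S * of_nat k :: ennreal"]] by (simp only:)
  qed
  also have "\<dots> = (\<Sum>k. \<integral>\<^sup>+S. of_nat k * indicator {S\<in>A. card S = k} S \<partial>Q)"
    using lev by (intro nn_integral_suminf) auto
  also have "\<dots> = (\<Sum>k. ennreal (real k * Q.prob {S\<in>A. card S = k}))"
    using lev by (simp add: nn_integral_cmult_indicator Q.emeasure_eq_measure ennreal_mult' ennreal_of_nat_eq_real_of_nat)
  finally show ?thesis .
qed

text \<open>Removing a point keeps a configuration finite, so \<open>removals finite_configs\<close>
  counts all points, and the Mecke formula turns the number of points into added mass.\<close>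

lemma expectation_card:
  assumes A: "A \<in> sets Q"
  shows "(\<integral>\<^sup>+S. indicator A S * of_nat (card S) \<partial>Q) = (\<integral>\<^sup>+S. adds A S \<partial>Q)"
proof -
  have fin: "finite_configs \<in> sets Q" by (simp add: sets_Q sigma_sets.Basic finite_configs_label_events)
  have "(\<integral>\<^sup>+S. indicator A S * of_nat (card S) \<partial>Q) = (\<integral>\<^sup>+S. indicator A S * removals finite_configs S \<partial>Q)"
    by (intro nn_integral_cong arg_cong2[where f = "(*)"] refl removals_space[symmetric])
      (simp add: space_Q finite_configs_def)
  also have "\<dots> = (\<integral>\<^sup>+S. indicator finite_configs S * adds A S \<partial>Q)"
    by (rule Mecke[OF fin A])
  also have "\<dots> = (\<integral>\<^sup>+S. adds A S \<partial>Q)"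
    by (intro nn_integral_cong) (simp add: space_Q)
  finally show ?thesis .
qed

text \<open>Passing from the Bochner integral to the nonnegative one uses measurability on all
  configurations, from \<open>measurable_adds\<close>; then the null set of infinite configurations
  is dropped.\<close>

lemma integral_measure_adds:
  assumes A: "A \<in> sets config_space"
  shows "(\<integral>S. measure \<mu> {x. S \<in> A \<and> insert x S \<notin> A} \<partial>P) =
    enn2real (\<integral>\<^sup>+S. indicator (A \<inter> finite_configs) S * adds (finite_configs - A) S \<partial>Q)"
proof -
  have cA: "configurations - A \<in> sets config_space"
    using A sets.compl_sets[of A config_space] by (simp add: space_config_space)
  have eq: "emeasure \<mu> {x. S \<in> A \<and> insert x S \<notin> A} = indicator A S * adds (configurations - A) S"
    if "S \<in> configurations" for S
    using that by (auto simp: adds_def insert_configurations split: split_indicator)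
  have "(\<lambda>S. indicator A S * adds (configurations - A) S) \<in> borel_measurable P"
    unfolding measurable_cong_sets[OF sets_P refl]
    using A by (intro borel_measurable_times_ennreal measurable_adds cA) auto
  then have meas: "(\<lambda>S. emeasure \<mu> {x. S \<in> A \<and> insert x S \<notin> A}) \<in> borel_measurable P"
    by (subst measurable_cong[OF eq]) (auto simp: space_P)
  have "(\<integral>S. measure \<mu> {x. S \<in> A \<and> insert x S \<notin> A} \<partial>P) =
    enn2real (\<integral>\<^sup>+S. ennreal (measure \<mu> {x. S \<in> A \<and> insert x S \<notin> A}) \<partial>P)"
    using meas by (intro integral_eq_nn_integral) (auto simp: measure_def)
  also have "(\<integral>\<^sup>+S. ennreal (measure \<mu> {x. S \<in> A \<and> insert x S \<notin> A}) \<partial>P) =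
      (\<integral>\<^sup>+S. emeasure \<mu> {x. S \<in> A \<and> insert x S \<notin> A} \<partial>Q)"
    by (simp add: emeasure_eq_measure[symmetric] nn_integral_Q)
  also have "\<dots> = (\<integral>\<^sup>+S. indicator (A \<inter> finite_configs) S * adds (finite_configs - A) S \<partial>Q)"
    by (intro nn_integral_cong) (auto simp: adds_def space_Q finite_configs_def split: split_indicator)
  finally show ?thesis .
qed

text \<open>Leaving \<open>A\<close> by a removal is the reverse of entering \<open>A\<close> by an
  addition, and the Mecke formula equates the two expectations.\<close>

lemma integral_measure_removals:
  assumes A: "A \<in> sets config_space"
  shows "(\<integral>S. measure (dirac_sum S) {x\<in>S. S \<in> A \<and> S - {x} \<notin> A} \<partial>P) =
    enn2real (\<integral>\<^sup>+S. indicator (finite_configs - A) S * adds (A \<inter> finite_configs) S \<partial>Q)"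
proof -
  let ?H = "\<lambda>S. emeasure (dirac_sum S) {x\<in>S. S \<in> A \<and> S - {x} \<notin> A}"
  have meas: "?H \<in> borel_measurable P"
    unfolding measurable_cong_sets[OF sets_P refl] by (rule measurable_count_pivotal[OF A])
  have "(\<integral>S. measure (dirac_sum S) {x\<in>S. S \<in> A \<and> S - {x} \<notin> A} \<partial>P) =
    enn2real (\<integral>\<^sup>+S. ennreal (enn2real (?H S)) \<partial>P)"
    using meas unfolding measure_def by (intro integral_eq_nn_integral) auto
  \<comment> \<open>\<open>enn2real\<close> sends infinite counts to 0, but these occur only on the
    null set that \<open>Q\<close> leaves out.\<close>
  also have "(\<integral>\<^sup>+S. ennreal (enn2real (?H S)) \<partial>P) = (\<integral>\<^sup>+S. ennreal (enn2real (?H S)) \<partial>Q)"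
    by (rule nn_integral_Q)
  also have "\<dots> = (\<integral>\<^sup>+S. indicator (A \<inter> finite_configs) S * removals (finite_configs - A) S \<partial>Q)"
  proof (rule nn_integral_cong)
    fix S assume "S \<in> space Q"
    then have S: "finite S" by (simp add: space_Q finite_configs_def)
    have "?H S = indicator (A \<inter> finite_configs) S * removals (finite_configs - A) S"
      using S by (auto simp: removals_def finite_configs_def split: split_indicator)
    moreover have "\<dots> < \<infinity>"
      using S by (simp add: removals_finite of_nat_less_top ennreal_mult_less_top split: split_indicator)
    ultimately show "ennreal (enn2real (?H S)) =
      indicator (A \<inter> finite_configs) S * removals (finite_configs - A) S" by simp
  qed
  also have "\<dots> = (\<integral>\<^sup>+S. indicator (finite_configs - A) S * adds (A \<inter> finite_configs) S \<partial>Q)"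
    by (rule Mecke[OF finite_configs_Diff_sets_Q[OF A] Int_finite_configs_sets_Q[OF A]])
  finally show ?thesis .
qed

end

lemma measure_scale_measure_ennreal:
  "0 \<le> t \<Longrightarrow> measure (scale_measure (ennreal t) M) B = t * measure M B"
  by (simp add: measure_def enn2real_mult)

text \<open>Each cell contributes an exponential and a power of \<open>t / l\<close>. Cell masses
  add up to the total mass and cell counts to \<open>size M\<close>, so the quotient of weights
  forgets the partition.\<close>

lemma poisson_weight_scale:
  fixes \<sigma> :: "'a::metric_space measure" and f :: "'a \<Rightarrow> nat"
  assumes "finite_measure \<sigma>" "sets \<sigma> = sets borel" "0 < t" "0 < l"
    and f: "\<And>x. f x < n" "f \<in> borel \<rightarrow>\<^sub>M count_space UNIV"
  shows "poisson_weight (scale_measure (ennreal t) \<sigma>) f n M =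
    exp (- (t - l) * measure \<sigma> UNIV) * (t / l) ^ size M * poisson_weight (scale_measure (ennreal l) \<sigma>) f n M"
proof (cases "set_mset M \<subseteq> {..<n}")
  case True
  interpret finite_measure \<sigma> by fact
  let ?s = "\<lambda>i. measure \<sigma> (f -` {i})"
  have b: "f -` {i} \<in> sets \<sigma>" for i
    using measurable_sets[OF f(2), of "{i}"] assms(2) by simp
  have "UNIV = (\<Union>i<n. f -` {i})" using f(1) by auto
  then have "measure \<sigma> UNIV = measure \<sigma> (\<Union>i<n. f -` {i})" by simp
  also have "\<dots> = (\<Sum>i<n. ?s i)"
    using b by (intro finite_measure_finite_Union) (auto simp: disjoint_family_on_def)
  finally have total: "measure \<sigma> UNIV = (\<Sum>i<n. ?s i)" .
  have size: "size M = (\<Sum>i<n. count M i)"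
    unfolding size_multiset_overloaded_eq using True
    by (intro sum.mono_neutral_left) (auto simp: not_in_iff)
  have "exp (- (t * ?s i)) * (t * ?s i) ^ count M i / fact (count M i) =
    (exp (- (t - l) * ?s i) * (t / l) ^ count M i) * (exp (- (l * ?s i)) * (l * ?s i) ^ count M i / fact (count M i))" for i
  proof -
    have "exp (- (t * ?s i)) = exp (- (t - l) * ?s i) * exp (- (l * ?s i))"
      by (simp add: exp_add[symmetric] algebra_simps)
    moreover have "(t * ?s i) ^ count M i = (t / l) ^ count M i * (l * ?s i) ^ count M i"
      using \<open>0 < l\<close> by (simp add: power_mult_distrib[symmetric])
    ultimately show ?thesis by simp
  qed
  note factor = this
  have weight: "poisson_weight (scale_measure (ennreal u) \<sigma>) f n M =
      (\<Prod>i<n. exp (- (u * ?s i)) * (u * ?s i) ^ count M i / fact (count M i))" if "0 < u" for u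
    using True that by (simp add: poisson_weight_def measure_scale_measure_ennreal)
  have "poisson_weight (scale_measure (ennreal t) \<sigma>) f n M =
      (\<Prod>i<n. (exp (- (t - l) * ?s i) * (t / l) ^ count M i)) * poisson_weight (scale_measure (ennreal l) \<sigma>) f n M"
    unfolding weight[OF \<open>0 < t\<close>] weight[OF \<open>0 < l\<close>] prod.distrib[symmetric]
    by (rule prod.cong[OF refl factor])
  also have "(\<Prod>i<n. (exp (- (t - l) * ?s i) * (t / l) ^ count M i)) =
      (\<Prod>i<n. exp (- (t - l) * ?s i)) * (\<Prod>i<n. (t / l) ^ count M i)"
    by (rule prod.distrib)
  also have "(\<Prod>i<n. exp (- (t - l) * ?s i)) = exp (- (t - l) * measure \<sigma> UNIV)"
    unfolding total sum_distrib_left by (rule exp_sum[symmetric]) simp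
  also have "(\<Prod>i<n. (t / l) ^ count M i) = (t / l) ^ size M"
    unfolding size by (rule power_sum[symmetric])
  finally show ?thesis .
qed (simp add: poisson_weight_def)

locale poisson_family =
  fixes \<sigma> :: "'a::metric_space measure" and \<pi> :: "real \<Rightarrow> 'a set measure"
  assumes sets_sigma: "sets \<sigma> = sets borel" and finite_sigma: "finite_measure \<sigma>"
    and diffuse_sigma: "\<And>x. emeasure \<sigma> {x} = 0"
    and poisson_pi: "\<And>t. t > 0 \<Longrightarrow> poisson_measure (scale_measure (ennreal t) \<sigma>) (\<pi> t)"
begin

lemma finite_poisson: "0 < t \<Longrightarrow> finite_poisson (scale_measure (ennreal t) \<sigma>) (\<pi> t)"
proof -
  interpret finite_measure \<sigma> by (rule finite_sigma)
  assume "0 < t"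
  show ?thesis
  proof (intro finite_poisson.intro finite_poisson_axioms.intro finite_measureI)
    show "emeasure (scale_measure (ennreal t) \<sigma>) (space (scale_measure (ennreal t) \<sigma>)) \<noteq> \<infinity>"
      using emeasure_finite by (simp add: ennreal_mult_eq_top_iff)
    show "poisson_measure (scale_measure (ennreal t) \<sigma>) (\<pi> t)"
      using \<open>0 < t\<close> by (rule poisson_pi)
  qed (simp_all add: sets_sigma diffuse_sigma)
qed

text \<open>The density depends on the number of points alone, which is the size of the label
  multiset for every partition; so one density works for all label events, and uniqueness extends
  it.\<close>

lemma emeasure_Q_density:
  assumes t: "0 < t" and l: "0 < l" and A: "A \<in> sets (finite_poisson.Q (\<pi> l))"
  shows "emeasure (finite_poisson.Q (\<pi> t)) A =
    (\<integral>\<^sup>+S. indicator A S * ennreal (exp (- (t - l) * measure \<sigma> UNIV) * (t / l) ^ card S) \<partial>finite_poisson.Q (\<pi> l))"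
proof -
  interpret T: finite_poisson "scale_measure (ennreal t) \<sigma>" "\<pi> t" by (rule finite_poisson[OF t])
  interpret L: finite_poisson "scale_measure (ennreal l) \<sigma>" "\<pi> l" by (rule finite_poisson[OF l])
  let ?c = "\<lambda>k. exp (- (t - l) * measure \<sigma> UNIV) * (t / l) ^ k"
  have c: "0 \<le> ?c k" for k using t l by simp
  note G = Int_stable_label_events[where 'a = 'a] label_events_subset[where 'a = 'a]
    finite_configs_label_events[where 'a = 'a]
  have sets_eq: "sets T.Q = sets L.Q" by (simp add: T.sets_Q L.sets_Q)
  show ?thesis
  proof (rule countably_additive_eqI[OF G, folded L.sets_Q, where A = A and \<phi> = "emeasure T.Q"
        and \<psi> = "\<lambda>A. \<integral>\<^sup>+S. indicator A S * ennreal (?c (card S)) \<partial>L.Q"])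
    show "positive (sets L.Q) (emeasure T.Q)"
      by (simp add: positive_def)
    show "countably_additive (sets L.Q) (emeasure T.Q)"
      using emeasure_countably_additive[of T.Q] by (simp add: sets_eq)
    show "emeasure T.Q finite_configs < \<infinity>"
      using T.Q.emeasure_finite[of finite_configs] by (metis infinity_ennreal_def less_top)
    show "positive (sets L.Q) (\<lambda>A. \<integral>\<^sup>+S. indicator A S * ennreal (?c (card S)) \<partial>L.Q)"
      by (rule L.positive_weighted)
    show "countably_additive (sets L.Q) (\<lambda>A. \<integral>\<^sup>+S. indicator A S * ennreal (?c (card S)) \<partial>L.Q)"
      by (rule L.countably_additive_weighted) (rule measurable_compose[OF L.measurable_card_Q], simp)
    fix A :: "'a set set" assume A: "A \<in> label_events"
    then obtain f n K where f: "f \<in> borel \<rightarrow>\<^sub>M count_space UNIV" "\<And>x. f x < n"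
      and AK: "A = {S \<in> finite_configs. labels f S \<in> K}"
      by (rule label_eventsE) (rule that)
    have "A \<in> sets T.Q" using A by (simp add: T.sets_Q sigma_sets.Basic)
    then have "emeasure T.Q A = (\<integral>\<^sup>+S. indicator A S \<partial>T.Q)" by simp
    also have "\<dots> = (\<integral>\<^sup>+S. of_bool (labels f S \<in> K) \<partial>T.Q)"
      unfolding AK by (intro nn_integral_cong) (simp add: T.space_Q indicator_def)
    also have "\<dots> = (\<integral>\<^sup>+M. of_bool (M \<in> K) * ennreal (poisson_weight (scale_measure (ennreal t) \<sigma>) f n M) \<partial>count_space UNIV)"
      by (rule T.nn_integral_labels[OF f(2,1)])
    also have "\<dots> = (\<integral>\<^sup>+M. of_bool (M \<in> K) * ennreal (?c (size M)) *
        ennreal (poisson_weight (scale_measure (ennreal l) \<sigma>) f n M) \<partial>count_space UNIV)"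
      unfolding poisson_weight_scale[OF finite_sigma sets_sigma t l f(2,1)]
        ennreal_mult[OF c poisson_weight_nonneg] by (simp only: mult.assoc)
    also have "\<dots> = (\<integral>\<^sup>+S. of_bool (labels f S \<in> K) * ennreal (?c (size (labels f S))) \<partial>L.Q)"
      by (rule L.nn_integral_labels[OF f(2,1), symmetric])
    also have "\<dots> = (\<integral>\<^sup>+S. indicator A S * ennreal (?c (card S)) \<partial>L.Q)"
      unfolding AK by (intro nn_integral_cong) (simp add: L.space_Q indicator_def)
    finally show "emeasure T.Q A = (\<integral>\<^sup>+S. indicator A S * ennreal (?c (card S)) \<partial>L.Q)" .
  qed (rule A)
qed

text \<open>The density is constant on each slice of configurations with \<open>k\<close>
  points.\<close>

lemma prob_sums:
  assumes t: "0 < t" and l: "0 < l" and A: "A \<in> sets config_space"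
  shows "(\<lambda>k. exp (- (t - l) * measure \<sigma> UNIV) * (t / l) ^ k *
      measure (finite_poisson.Q (\<pi> l)) {S \<in> A \<inter> finite_configs. card S = k}) sums measure (\<pi> t) A"
proof -
  interpret T: finite_poisson "scale_measure (ennreal t) \<sigma>" "\<pi> t" by (rule finite_poisson[OF t])
  interpret L: finite_poisson "scale_measure (ennreal l) \<sigma>" "\<pi> l" by (rule finite_poisson[OF l])
  let ?c = "\<lambda>k. exp (- (t - l) * measure \<sigma> UNIV) * (t / l) ^ k"
  let ?A = "\<lambda>k. {S \<in> A \<inter> finite_configs. card S = k}"
  have c: "0 \<le> ?c k" for k using t l by simp
  have lev: "?A k \<in> sets L.Q" for k
  proof -
    have "?A k = (A \<inter> finite_configs) \<inter> {S \<in> finite_configs. card S = k}" by auto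
    then show ?thesis
      using sets.Int[OF L.Int_finite_configs_sets_Q[OF A] L.card_level_sets[of k]] by simp
  qed
  have "measure T.Q (?A k) = ?c k * measure L.Q (?A k)" for k
  proof -
    have "emeasure T.Q (?A k) = (\<integral>\<^sup>+S. indicator (?A k) S * ennreal (?c (card S)) \<partial>L.Q)"
      by (rule emeasure_Q_density[OF t l lev])
    also have "\<dots> = (\<integral>\<^sup>+S. ennreal (?c k) * indicator (?A k) S \<partial>L.Q)"
      by (intro nn_integral_cong) (auto split: split_indicator)
    also have "\<dots> = ennreal (?c k * measure L.Q (?A k))"
      using lev c by (simp add: nn_integral_cmult_indicator L.Q.emeasure_eq_measure ennreal_mult)
    finally show ?thesis using c by (simp add: measure_def)
  qed
  moreover have "(\<lambda>k. measure T.Q (?A k)) sums measure T.Q (\<Union>k. ?A k)"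
    using lev by (intro T.Q.finite_measure_UNION) (auto simp: disjoint_family_on_def T.sets_Q L.sets_Q)
  moreover have "(\<Union>k. ?A k) = A \<inter> finite_configs" by auto
  ultimately show ?thesis using T.prob_eq_Q[OF A] by simp
qed

end

subsection \<open>The derivative of the probability\<close>

context poisson_family
begin

text \<open>Multiplication by \<open>exp ((t - l) * measure \<sigma> UNIV)\<close> turns the
  probability into a power series in \<open>t / l\<close>, which is differentiated termwise at 1
  instead of differentiating under the expectation.\<close>

lemma has_real_derivative_prob:
  assumes l: "0 < l" and A: "A \<in> sets config_space"
  shows "((\<lambda>t. measure (\<pi> t) A) has_real_derivative
    enn2real (\<integral>\<^sup>+S. finite_poisson.adds (scale_measure (ennreal l) \<sigma>) (A \<inter> finite_configs) S
      \<partial>finite_poisson.Q (\<pi> l)) / l - measure \<sigma> UNIV * measure (\<pi> l) A) (at l)"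
proof -
  interpret L: finite_poisson "scale_measure (ennreal l) \<sigma>" "\<pi> l" by (rule finite_poisson[OF l])
  let ?s = "measure \<sigma> UNIV"
  define p where "p k = measure L.Q {S \<in> A \<inter> finite_configs. card S = k}" for k
  have sums: "(\<lambda>k. exp (- (t - l) * ?s) * (t / l) ^ k * p k) sums measure (\<pi> t) A" if "0 < t" for t
    unfolding p_def by (rule prob_sums[OF that l A])
  have psums: "(\<lambda>k. p k * (t / l) ^ k) sums (exp ((t - l) * ?s) * measure (\<pi> t) A)" if "0 < t" for t
  proof -
    have eq: "exp ((t - l) * ?s) * (exp (- (t - l) * ?s) * (t / l) ^ k * p k) = p k * (t / l) ^ k" for k
    proof -
      have "exp ((t - l) * ?s) * exp (- (t - l) * ?s) = 1"
        by (simp add: exp_add[symmetric] algebra_simps)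
      then show ?thesis by (metis mult.assoc mult.commute mult.left_neutral)
    qed
    then show ?thesis using sums_mult[OF sums[OF that], of "exp ((t - l) * ?s)"] by (simp only: eq)
  qed
  define G where "G y = (\<Sum>k. p k * y ^ k)" for y
  \<comment> \<open>The choice \<open>t = 2 * l\<close> yields convergence at 2, so 1 lies strictly
    inside the disc of convergence.\<close>
  have sm: "summable (\<lambda>k. p k * 2 ^ k)"
    using psums[of "2 * l"] l by (simp add: sums_iff)
  define G' where "G' = (\<Sum>k. diffs p k * 1 ^ k)"
  have G: "DERIV G 1 :> G'"
    unfolding G_def[abs_def] G'_def by (rule termdiffs_strong[OF sm]) simp
  have "summable (\<lambda>k. diffs p k * 1 ^ k)"
    by (rule termdiff_converges[where K = 2]) (auto intro: powser_inside[OF sm])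
  \<comment> \<open>Shifting the index of \<open>diffs\<close> turns the derivative series at 1 into
    the mean number of points on \<open>A\<close>.\<close>
  from diffs_equiv[OF this] have G'_sums: "(\<lambda>k. real k * p k) sums G'"
    by (simp add: G'_def)
  have adds: "(\<integral>\<^sup>+S. L.adds (A \<inter> finite_configs) S \<partial>L.Q) = ennreal G'"
  proof -
    have "(\<integral>\<^sup>+S. L.adds (A \<inter> finite_configs) S \<partial>L.Q) = (\<Sum>k. ennreal (real k * p k))"
      unfolding p_def
      by (simp only: L.expectation_card[symmetric] L.nn_integral_card L.Int_finite_configs_sets_Q[OF A])
    also have "\<dots> = ennreal G'"
      by (rule suminf_ennreal_eq[OF _ G'_sums]) (simp add: p_def)
    finally show ?thesis .
  qed
  have "0 \<le> G'"
    by (rule sums_le[OF _ sums_zero G'_sums]) (simp add: p_def)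
  have at_l: "G 1 = measure (\<pi> l) A"
    using psums[OF l] l by (simp add: G_def sums_iff)
  have prob: "exp (- (t - l) * ?s) * G (t / l) = measure (\<pi> t) A" if "t \<in> {0<..}" for t
  proof -
    have "G (t / l) = exp ((t - l) * ?s) * measure (\<pi> t) A"
      using psums[of t] that by (simp add: G_def sums_iff)
    moreover have "exp (- (t - l) * ?s) * exp ((t - l) * ?s) = 1"
      by (simp add: exp_add[symmetric] algebra_simps)
    ultimately show ?thesis by (metis mult.assoc mult.left_neutral)
  qed
  have chain: "((\<lambda>t. G (t / l)) has_real_derivative G' * (1 / l)) (at l)"
  proof (rule DERIV_chain2[where f = G and g = "\<lambda>t. t / l"])
    show "DERIV G (l / l) :> G'" using G l by simp
    show "((\<lambda>t. t / l) has_real_derivative 1 / l) (at l)"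
      using DERIV_cdivide[OF DERIV_ident] .
  qed
  have "((\<lambda>t. exp (- (t - l) * ?s) * G (t / l)) has_real_derivative
      G' / l - ?s * measure (\<pi> l) A) (at l)"
    using l by (auto intro!: derivative_eq_intros chain simp: at_l)
  then have "((\<lambda>t. measure (\<pi> t) A) has_real_derivative G' / l - ?s * measure (\<pi> l) A) (at l)"
    by (rule has_field_derivative_transform_within_open[OF _ open_greaterThan _ prob]) (use l in auto)
  then show ?thesis
    using \<open>0 \<le> G'\<close> by (simp add: adds)
qed

end

section \<open>Integrals of the positive and negative parts of the difference operator\<close>

lemma integral_D_plus_diffuse:
  fixes M :: "'a::metric_space measure"
  assumes S: "S \<in> configurations" and A: "A \<in> sets config_space"
    and M: "sets M = sets borel" "\<And>x. emeasure M {x} = 0"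
  shows "(\<integral>x. D_plus x (indicator A) S \<partial>M) = measure M {x. S \<in> A \<and> insert x S \<notin> A}"
proof -
  have "space M = UNIV" using sets_eq_imp_space_eq[OF M(1)] by simp
  have "(\<integral>x. D_plus x (indicator A) S \<partial>M) =
      (\<integral>x. indicator {x. S \<in> A \<and> insert x S \<notin> A} x \<partial>M)"
  \<comment> \<open>The removal branch of \<open>D\<close> lives on the countable null set
    \<open>S\<close>; off \<open>S\<close>, \<open>D_plus\<close> is 1 exactly when the addition
    leaves \<open>A\<close>.\<close>
  proof (rule integral_discrete_difference[where X = S])
    show "D_plus x (indicator A) S = indicator {x. S \<in> A \<and> insert x S \<notin> A} x"
      if "x \<notin> S" for x
      using that by (auto simp: D_plus_def D_def indicator_def)
  qed (use S M in \<open>auto simp: configurations_countable\<close>)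
  then show ?thesis using \<open>space M = UNIV\<close> by simp
qed

lemma integral_D_plus_dirac_sum:
  fixes A :: "'a::metric_space set set"
  assumes S: "S \<in> configurations" and A: "A \<in> sets config_space"
  shows "(\<integral>x. D_plus x (indicator A) S \<partial>dirac_sum S) = measure (dirac_sum S) {x\<in>S. S \<in> A \<and> S - {x} \<notin> A}"
proof -
  let ?E = "{x\<in>S. S \<in> A \<and> S - {x} \<notin> A}"
  \<comment> \<open>Transfer to the counting measure on \<open>S\<close> requires Borel
    measurability on the whole space, including the addition branch off \<open>S\<close>.\<close>
  have "(\<lambda>x. D_plus x (indicator A) S) \<in> borel_measurable borel"
  proof (rule measurable_discrete_difference[where X = S])
    have "{x. S \<in> A \<and> insert x S \<notin> A} \<in> sets borel"
    proof (cases "S \<in> A")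
      case True
      then have "{x. S \<in> A \<and> insert x S \<notin> A} = space borel - {x. insert x S \<in> A}" by auto
      then show ?thesis using insert_preimage_borel[OF S A] by (simp only: sets.compl_sets)
    qed simp
    then show "indicator {x. S \<in> A \<and> insert x S \<notin> A} \<in> borel_measurable borel" by simp
    show "indicator {x. S \<in> A \<and> insert x S \<notin> A} x = D_plus x (indicator A) S" if "x \<notin> S" for x
      using that by (auto simp: D_plus_def D_def indicator_def)
  qed (use S in \<open>auto simp: configurations_countable\<close>)
  then have "(\<integral>x. D_plus x (indicator A) S \<partial>dirac_sum S) = (\<integral>x. D_plus x (indicator A) S \<partial>count_space S)"
    unfolding dirac_sum_def by (intro integral_distr) auto
  also have "\<dots> = (\<integral>x. indicator ?E x \<partial>count_space S)"
    by (intro Bochner_Integration.integral_cong) (auto simp: D_plus_def D_def indicator_def)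
  also have "\<dots> = measure (count_space S) (S \<inter> ?E)"
    by (simp add: Int_commute)
  also have "\<dots> = measure (dirac_sum S) ?E"
  proof -
    have "?E \<in> sets borel" using configurations_subset_borel[OF S, of ?E] by auto
    then show ?thesis unfolding measure_def by (simp only: emeasure_dirac_sum)
  qed
  finally show ?thesis .
qed

text \<open>Complementing the event flips the sign of \<open>D\<close>. Complements are relative to
  \<open>configurations\<close>, so closure under adding and removing a point enters.\<close>

lemma D_minus_indicator:
  assumes "S \<in> configurations"
  shows "D_minus x (indicator A) S = D_plus x (indicator (configurations - A)) S"
  using assms insert_configurations[OF assms, of x] Diff_configurations[OF assms, of "{x}"]
  by (auto simp: D_minus_def D_plus_def D_def indicator_def)

context finite_poisson
begin

lemma integral_D_plus_mu:
  assumes A: "A \<in> sets config_space" and \<mu>: "\<mu> = scale_measure (ennreal l) \<sigma>" "0 < l"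
    and \<sigma>: "sets \<sigma> = sets borel" "\<And>x. emeasure \<sigma> {x} = 0"
  shows "(\<integral>S. (\<integral>x. D_plus x (indicator A) S \<partial>\<sigma>) \<partial>P) =
    (1 / l) * enn2real (\<integral>\<^sup>+S. indicator (A \<inter> finite_configs) S * adds (finite_configs - A) S \<partial>Q)"
proof -
  have "(\<integral>S. (\<integral>x. D_plus x (indicator A) S \<partial>\<sigma>) \<partial>P) =
      (\<integral>S. (1 / l) * measure \<mu> {x. S \<in> A \<and> insert x S \<notin> A} \<partial>P)"
    using \<mu> by (intro Bochner_Integration.integral_cong refl)
      (simp add: space_P integral_D_plus_diffuse[OF _ A \<sigma>] measure_scale_measure_ennreal)
  also have "\<dots> = (1 / l) * (\<integral>S. measure \<mu> {x. S \<in> A \<and> insert x S \<notin> A} \<partial>P)"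
    by (rule integral_mult_right_zero)
  finally show ?thesis unfolding integral_measure_adds[OF A] .
qed

lemma integral_D_plus_config:
  assumes A: "A \<in> sets config_space"
  shows "(\<integral>S. (\<integral>x. D_plus x (indicator A) S \<partial>dirac_sum S) \<partial>P) =
    enn2real (\<integral>\<^sup>+S. indicator (finite_configs - A) S * adds (A \<inter> finite_configs) S \<partial>Q)"
  unfolding integral_measure_removals[OF A, symmetric]
  by (intro Bochner_Integration.integral_cong refl) (simp add: space_P integral_D_plus_dirac_sum[OF _ A])

end

section \<open>Balance of additions into and out of an event\<close>

context finite_poisson
begin

lemma expectation_adds_split:
  assumes A: "A \<in> sets config_space"
  shows "(\<integral>\<^sup>+S. adds (A \<inter> finite_configs) S \<partial>Q) =
    (\<integral>\<^sup>+S. indicator (A \<inter> finite_configs) S * adds (A \<inter> finite_configs) S \<partial>Q) +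
    (\<integral>\<^sup>+S. indicator (finite_configs - A) S * adds (A \<inter> finite_configs) S \<partial>Q)"
proof -
  note sets = Int_finite_configs_sets_Q[OF A] finite_configs_Diff_sets_Q[OF A]
  have "adds (A \<inter> finite_configs) \<in> borel_measurable Q"
    by (intro measurable_Q measurable_adds sets_Q_config_space sets)
  then show ?thesis
    using sets by (subst nn_integral_add[symmetric])
      (auto intro!: nn_integral_cong borel_measurable_times_ennreal simp: space_Q split: split_indicator)
qed

text \<open>Every addition to a finite configuration ends either in \<open>A\<close> or in its
  complement, so the two masses make up the total mass.\<close>

lemma expectation_adds_compl:
  assumes A: "A \<in> sets config_space"
  shows "(\<integral>\<^sup>+S. indicator (A \<inter> finite_configs) S * adds (A \<inter> finite_configs) S \<partial>Q) +
    (\<integral>\<^sup>+S. indicator (A \<inter> finite_configs) S * adds (finite_configs - A) S \<partial>Q) =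
    ennreal (measure \<mu> UNIV * P.prob A)"
proof -
  note sets = Int_finite_configs_sets_Q[OF A] finite_configs_Diff_sets_Q[OF A]
  have meas: "adds (A \<inter> finite_configs) \<in> borel_measurable Q" "adds (finite_configs - A) \<in> borel_measurable Q"
    by (intro measurable_Q measurable_adds sets_Q_config_space sets)+
  have total: "adds (A \<inter> finite_configs) S + adds (finite_configs - A) S = emeasure \<mu> UNIV" if S: "S \<in> space Q" for S
  proof -
    have "S \<in> configurations" "finite S"
      using S finite_configs_subset by (auto simp: space_Q finite_configs_def)
    then have "{x. insert x S \<in> A \<inter> finite_configs} \<in> sets \<mu>" "{x. insert x S \<in> finite_configs - A} \<in> sets \<mu>"
      using insert_preimage_borel[OF _ sets_Q_config_space[OF sets(1)], of S]
        insert_preimage_borel[OF _ sets_Q_config_space[OF sets(2)], of S] sets_mu by simp_all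
    then have "adds (A \<inter> finite_configs) S + adds (finite_configs - A) S =
      emeasure \<mu> ({x. insert x S \<in> A \<inter> finite_configs} \<union> {x. insert x S \<in> finite_configs - A})"
      unfolding adds_def by (intro plus_emeasure) auto
    also have "{x. insert x S \<in> A \<inter> finite_configs} \<union> {x. insert x S \<in> finite_configs - A} = UNIV"
      using \<open>finite S\<close> by (auto simp: finite_configs_def)
    finally show ?thesis .
  qed
  have "(\<integral>\<^sup>+S. indicator (A \<inter> finite_configs) S * adds (A \<inter> finite_configs) S \<partial>Q) +
      (\<integral>\<^sup>+S. indicator (A \<inter> finite_configs) S * adds (finite_configs - A) S \<partial>Q) =
      (\<integral>\<^sup>+S. indicator (A \<inter> finite_configs) S * adds (A \<inter> finite_configs) S +
        indicator (A \<inter> finite_configs) S * adds (finite_configs - A) S \<partial>Q)"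
    using sets meas by (intro nn_integral_add[symmetric] borel_measurable_times_ennreal) auto
  also have "\<dots> = (\<integral>\<^sup>+S. emeasure \<mu> UNIV * indicator (A \<inter> finite_configs) S \<partial>Q)"
    by (intro nn_integral_cong) (simp add: total distrib_left[symmetric] mult.commute)
  also have "\<dots> = ennreal (measure \<mu> UNIV * P.prob A)"
    using sets by (simp add: nn_integral_cmult_indicator prob_eq_Q[OF A] Q.emeasure_eq_measure
        emeasure_eq_measure ennreal_mult)
  finally show ?thesis .
qed

lemma increasing_adds_compl:
  assumes inc: "\<forall>S\<in>A. AE x in \<mu>. insert x S \<in> A"
  shows "(\<integral>\<^sup>+S. indicator (A \<inter> finite_configs) S * adds (finite_configs - A) S \<partial>Q) = 0"
proof -
  have "indicator (A \<inter> finite_configs) S * adds (finite_configs - A) S = 0" for S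
  proof (cases "S \<in> A")
    case True
    with inc have "AE x in \<mu>. insert x S \<in> A" by blast
    then obtain N where "{x \<in> space \<mu>. insert x S \<notin> A} \<subseteq> N" "emeasure \<mu> N = 0" "N \<in> sets \<mu>"
      by (rule AE_E)
    moreover then have "{x. insert x S \<in> finite_configs - A} \<subseteq> N" by (auto simp: space_mu)
    ultimately have "adds (finite_configs - A) S \<le> 0"
      unfolding adds_def using emeasure_mono[of _ N \<mu>] by metis
    then show ?thesis by simp
  qed simp
  then have "(\<integral>\<^sup>+S. indicator (A \<inter> finite_configs) S * adds (finite_configs - A) S \<partial>Q) = (\<integral>\<^sup>+S. 0 \<partial>Q)"
    by (intro nn_integral_cong)
  then show ?thesis by simp
qed

text \<open>The hypothesis concerns removals from \<open>A\<close> and the claim additions into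
  \<open>A\<close>; the Mecke formula links them. On a finite configuration each point has mass 1,
  so almost every point means every point.\<close>

lemma decreasing_adds:
  assumes dec: "decreasing_event A"
  shows "(\<integral>\<^sup>+S. indicator (finite_configs - A) S * adds (A \<inter> finite_configs) S \<partial>Q) = 0"
proof -
  have A: "A \<in> sets config_space" using dec by (simp add: decreasing_event_def)
  have "indicator (A \<inter> finite_configs) S * removals (finite_configs - A) S = 0" for S
  proof (cases "S \<in> A \<and> finite S")
    case True
    have "S - {x} \<in> A" if "x \<in> S" for x
    proof (rule ccontr)
      assume "S - {x} \<notin> A"
      have "AE x in dirac_sum S. S - {x} \<in> A"
        using dec True by (simp add: decreasing_event_def)
      then obtain N where N: "{x \<in> space (dirac_sum S). S - {x} \<notin> A} \<subseteq> N"
        "emeasure (dirac_sum S) N = 0" "N \<in> sets (dirac_sum S)"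
        by (rule AE_E)
      then have "x \<in> S \<inter> N" using \<open>S - {x} \<notin> A\<close> that by auto
      moreover have "of_nat (card (S \<inter> N)) = (0 :: ennreal)"
        using N True by (simp add: emeasure_dirac_sum_finite)
      ultimately show False using True by auto
    qed
    then have "{x\<in>S. S - {x} \<in> finite_configs - A} = {}" by auto
    then show ?thesis unfolding removals_def by (simp only: emeasure_empty mult_zero_right)
  qed (auto simp: finite_configs_def)
  then have "(\<integral>\<^sup>+S. indicator (A \<inter> finite_configs) S * removals (finite_configs - A) S \<partial>Q) = (\<integral>\<^sup>+S. 0 \<partial>Q)"
    by (intro nn_integral_cong)
  then show ?thesis
    using Mecke[OF finite_configs_Diff_sets_Q[OF A] Int_finite_configs_sets_Q[OF A]] by simp
qed

lemma integral_D_minus_mu: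
  assumes A: "A \<in> sets config_space" and \<mu>: "\<mu> = scale_measure (ennreal l) \<sigma>" "0 < l"
    and \<sigma>: "sets \<sigma> = sets borel" "\<And>x. emeasure \<sigma> {x} = 0"
  shows "(\<integral>S. (\<integral>x. D_minus x (indicator A) S \<partial>\<sigma>) \<partial>P) =
    (1 / l) * enn2real (\<integral>\<^sup>+S. indicator (finite_configs - A) S * adds (A \<inter> finite_configs) S \<partial>Q)"
proof -
  have cA: "configurations - A \<in> sets config_space"
    using A sets.compl_sets[of A config_space] by (simp add: space_config_space)
  have "(\<integral>S. (\<integral>x. D_minus x (indicator A) S \<partial>\<sigma>) \<partial>P) =
      (\<integral>S. (\<integral>x. D_plus x (indicator (configurations - A)) S \<partial>\<sigma>) \<partial>P)"
    by (intro Bochner_Integration.integral_cong refl) (simp add: space_P D_minus_indicator)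
  moreover have "(configurations - A) \<inter> finite_configs = finite_configs - A"
    "finite_configs - (configurations - A) = A \<inter> finite_configs"
    using finite_configs_subset by auto
  ultimately show ?thesis
    using integral_D_plus_mu[OF cA \<mu> \<sigma>] by simp
qed

lemma integral_D_minus_config:
  assumes A: "A \<in> sets config_space"
  shows "(\<integral>S. (\<integral>x. D_minus x (indicator A) S \<partial>dirac_sum S) \<partial>P) =
    enn2real (\<integral>\<^sup>+S. indicator (A \<inter> finite_configs) S * adds (finite_configs - A) S \<partial>Q)"
proof -
  have cA: "configurations - A \<in> sets config_space"
    using A sets.compl_sets[of A config_space] by (simp add: space_config_space)
  have "(\<integral>S. (\<integral>x. D_minus x (indicator A) S \<partial>dirac_sum S) \<partial>P) =
      (\<integral>S. (\<integral>x. D_plus x (indicator (configurations - A)) S \<partial>dirac_sum S) \<partial>P)"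
    by (intro Bochner_Integration.integral_cong refl) (simp add: space_P D_minus_indicator)
  moreover have "(configurations - A) \<inter> finite_configs = finite_configs - A"
    "finite_configs - (configurations - A) = A \<inter> finite_configs"
    using finite_configs_subset by auto
  ultimately show ?thesis
    using integral_D_plus_config[OF cA] by simp
qed

end

theorem corollary2p8:
  fixes \<sigma> :: "'a::metric_space measure"
    and \<pi> :: "real \<Rightarrow> 'a set measure"
    and A :: "'a set set"
    and l :: real
  assumes "sets \<sigma> = sets borel"
    and "finite_measure \<sigma>"
    and "\<And>x. emeasure \<sigma> {x} = 0"
    and "\<And>t. t > 0 \<Longrightarrow> poisson_measure (scale_measure (ennreal t) \<sigma>) (\<pi> t)"
    and "l > 0"
  shows "(increasing_event \<sigma> A \<longrightarrow>
            ((\<lambda>t. measure (\<pi> t) A) has_real_derivative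
               (\<integral>\<omega>. (\<integral>x. D_minus x (indicator A) \<omega> \<partial>\<sigma>) \<partial>\<pi> l)) (at l) \<and>
            (\<integral>\<omega>. (\<integral>x. D_minus x (indicator A) \<omega> \<partial>\<sigma>) \<partial>\<pi> l)
              = (1 / l) * (\<integral>\<omega>. (\<integral>x. D_plus x (indicator A) \<omega> \<partial>dirac_sum \<omega>) \<partial>\<pi> l)) \<and>
         (decreasing_event A \<longrightarrow>
            ((\<lambda>t. measure (\<pi> t) A) has_real_derivative
               - ((1 / l) * (\<integral>\<omega>. (\<integral>x. D_minus x (indicator A) \<omega> \<partial>dirac_sum \<omega>) \<partial>\<pi> l))) (at l) \<and>
            - ((1 / l) * (\<integral>\<omega>. (\<integral>x. D_minus x (indicator A) \<omega> \<partial>dirac_sum \<omega>) \<partial>\<pi> l))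
              = - (\<integral>\<omega>. (\<integral>x. D_plus x (indicator A) \<omega> \<partial>\<sigma>) \<partial>\<pi> l))"
proof -
  interpret F: poisson_family \<sigma> \<pi>
    by (rule poisson_family.intro) (fact assms)+
  interpret L: finite_poisson "scale_measure (ennreal l) \<sigma>" "\<pi> l"
    by (rule F.finite_poisson[OF \<open>l > 0\<close>])
  let ?A = "A \<inter> finite_configs" and ?B = "finite_configs - A"
  \<comment> \<open>The first letter tells where the configuration starts, the second where the
    addition leads.\<close>
  let ?AA = "\<integral>\<^sup>+S. indicator ?A S * L.adds ?A S \<partial>L.Q"
  let ?AB = "\<integral>\<^sup>+S. indicator ?A S * L.adds ?B S \<partial>L.Q"
  let ?BA = "\<integral>\<^sup>+S. indicator ?B S * L.adds ?A S \<partial>L.Q"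
  have scale: "measure (scale_measure (ennreal l) \<sigma>) UNIV = l * measure \<sigma> UNIV"
    using \<open>l > 0\<close> by (simp add: measure_scale_measure_ennreal)
  \<comment> \<open>\<open>?AA\<close> occurs both in the mean number of points on \<open>A\<close>
    and in the mass term, and cancels.\<close>
  have deriv: "((\<lambda>t. measure (\<pi> t) A) has_real_derivative
      (enn2real ?BA - enn2real ?AB) / l) (at l)" if A: "A \<in> sets config_space"
  proof -
    have fin: "?AA < \<infinity>" "?AB < \<infinity>" "?BA < \<infinity>" by (rule L.adds_integral_finite)+
    have "enn2real (\<integral>\<^sup>+S. L.adds ?A S \<partial>L.Q) = enn2real ?AA + enn2real ?BA"
      unfolding L.expectation_adds_split[OF A] using fin by (intro enn2real_plus) auto
    moreover have "enn2real ?AA + enn2real ?AB = l * measure \<sigma> UNIV * measure (\<pi> l) A"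
    proof -
      have "enn2real ?AA + enn2real ?AB = enn2real (?AA + ?AB)"
        using fin by (intro enn2real_plus[symmetric]) auto
      then show ?thesis
        unfolding L.expectation_adds_compl[OF A] scale using \<open>l > 0\<close> by simp
    qed
    ultimately have "(enn2real ?BA - enn2real ?AB) / l =
        enn2real (\<integral>\<^sup>+S. L.adds ?A S \<partial>L.Q) / l - measure \<sigma> UNIV * measure (\<pi> l) A"
      using \<open>l > 0\<close> by (simp add: field_simps)
    then show ?thesis
      using F.has_real_derivative_prob[OF \<open>l > 0\<close> A] by (simp only:)
  qed
  note \<sigma> = refl \<open>l > 0\<close> assms(1,3)
  show ?thesis
  proof (intro conjI[where P = "_ \<longrightarrow> _"] impI)
    assume inc: "increasing_event \<sigma> A"
    then have A: "A \<in> sets config_space" by (simp add: increasing_event_def)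
    \<comment> \<open>A null set of \<sigma> stays null after scaling, which carries the hypothesis
      to the intensity of the locale.\<close>
    have "\<forall>S\<in>A. AE x in scale_measure (ennreal l) \<sigma>. insert x S \<in> A"
    proof
      fix S assume "S \<in> A"
      with inc have "AE x in \<sigma>. insert x S \<in> A" by (simp add: increasing_event_def)
      then obtain N where "{x \<in> space \<sigma>. insert x S \<notin> A} \<subseteq> N" "emeasure \<sigma> N = 0" "N \<in> sets \<sigma>"
        by (rule AE_E)
      then show "AE x in scale_measure (ennreal l) \<sigma>. insert x S \<in> A"
        using sets_eq_imp_space_eq[OF sets_scale_measure[of "ennreal l" \<sigma>]] by (intro AE_I[of _ _ N]) auto
    qed
    then have "?AB = 0" by (rule L.increasing_adds_compl)
    then show "((\<lambda>t. measure (\<pi> t) A) has_real_derivative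
          (\<integral>\<omega>. (\<integral>x. D_minus x (indicator A) \<omega> \<partial>\<sigma>) \<partial>\<pi> l)) (at l) \<and>
        (\<integral>\<omega>. (\<integral>x. D_minus x (indicator A) \<omega> \<partial>\<sigma>) \<partial>\<pi> l)
          = (1 / l) * (\<integral>\<omega>. (\<integral>x. D_plus x (indicator A) \<omega> \<partial>dirac_sum \<omega>) \<partial>\<pi> l)"
      using deriv[OF A] unfolding L.integral_D_minus_mu[OF A \<sigma>] L.integral_D_plus_config[OF A] by simp
  next
    assume dec: "decreasing_event A"
    then have A: "A \<in> sets config_space" by (simp add: decreasing_event_def)
    have "?BA = 0" by (rule L.decreasing_adds[OF dec])
    then show "((\<lambda>t. measure (\<pi> t) A) has_real_derivative
          - ((1 / l) * (\<integral>\<omega>. (\<integral>x. D_minus x (indicator A) \<omega> \<partial>dirac_sum \<omega>) \<partial>\<pi> l))) (at l) \<and>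
        - ((1 / l) * (\<integral>\<omega>. (\<integral>x. D_minus x (indicator A) \<omega> \<partial>dirac_sum \<omega>) \<partial>\<pi> l))
          = - (\<integral>\<omega>. (\<integral>x. D_plus x (indicator A) \<omega> \<partial>\<sigma>) \<partial>\<pi> l)"
      using deriv[OF A] unfolding L.integral_D_minus_config[OF A] L.integral_D_plus_mu[OF A \<sigma>] by simp
  qed
qed

end
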